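(* Let $(Q,\lhd)$ be a quandle and $A$ an abelian group. Suppose that for some odd $k$ and some $c_1,\ldots,c_k\in Q$ and $\varepsilon_1,\ldots,\varepsilon_k\in\{\pm1\}$, the relation $$(\cdots(a\lhd^{\varepsilon_1}c_1)\lhd^{\varepsilon_2}\cdots)\lhd^{\varepsilon_k}c_k=a$$ holds for all $a\in Q$, where $\lhd^{+1}=\lhd$ and $\lhd^{-1}=\widetilde{\lhd}$. Then all non-trivial positive weights are of order $2$ in $A$: for every positive quandle $2$-cocycle $\omega\colon Q\times Q\to A$ and every $Q$-colored knot diagram $(D,\mathcal{C})$, if $\mathcal{W}^{pos}_\omega(D,\mathcal{C})\neq0$ then $\mathcal{W}^{pos}_\omega(D,\mathcal{C})$ has order $2$ in $A$.
   Context: Quandle: a set $Q$ with operations $\lhd,\widetilde{\lhd}$ such that $(a\lhd b)\lhd c=(a\lhd c)\lhd(b\lhd c)$, $(a\lhd b)\,\widetilde{\lhd}\,b=(a\,\widetilde{\lhd}\,b)\lhd b=a$, $a\lhd a=a$ for all $a,b,c\in Q$. Knots: "knot" means oriented knot or link in $\mathbb{R}^3$; a knot diagram $D$ is a diagram in $\mathbb{R}^2$ of such a link. Arcs run from undercrossing to undercrossing (or are closed curves). Regions are the connected components of $\mathbb{R}^2\setminus D$. Left and right of an oriented arc are as seen when travelling along it. A $Q$-coloring $\mathcal{C}$ of $D$ assigns an element of $Q$ to each arc such that at each crossing, if the over-arc has color $b$ and the under-arc on the right of the over-arc has color $a$, then the under-arc on the left of the over-arc has color $a\lhd b$. A $Q$-colored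 diagram is a pair $(D,\mathcal{C})$. The positive $\omega$-weight is $\mathcal{W}^{pos}_\omega(D,\mathcal{C})=\sum_x\varepsilon^{pos}(x)\,\omega(a_x,b_x)$, summed over all crossings $x$, where $b_x$ is the color of the over-arc and $a_x$ the color of the under-arc lying on the right of the over-arc. Here one takes the checkerboard (black/white) coloring of the regions of $D$ with the exterior (unbounded) region white, and $\varepsilon^{pos}(x)=+1$ if the two regions swept by rotating the over-strand at $x$ counterclockwise until it meets the under-strand are black, $\varepsilon^{pos}(x)=-1$ if they are white. A positive quandle $2$-cocycle is a map $\omega\colon Q\times Q\to A$ with $\omega(a,a)=0$ and $\omega(a,c)+\omega(a\lhd b,c)=\omega(a\lhd c,b\lhd c)+\omega(a,b)+2\omega(b,c)$ for all $a,b,c\in Q$. *)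

theory Defs
  imports "HOL-Analysis.Analysis"
begin

section \<open>Quandles and positive cocycles\<close>

locale quandle =
  fixes Q :: "'q set"
    and rhd :: "'q \<Rightarrow> 'q \<Rightarrow> 'q"  (infixl \<open>\<lhd>\<close> 70)
    and rhd_inv :: "'q \<Rightarrow> 'q \<Rightarrow> 'q"  (infixl \<open>\<lhd>\<^sup>~\<close> 70)
  assumes closed: "a \<in> Q \<Longrightarrow> b \<in> Q \<Longrightarrow> a \<lhd> b \<in> Q"
    and closed_inv: "a \<in> Q \<Longrightarrow> b \<in> Q \<Longrightarrow> a \<lhd>\<^sup>~ b \<in> Q"
    and self_distrib: "a \<in> Q \<Longrightarrow> b \<in> Q \<Longrightarrow> c \<in> Q \<Longrightarrow> (a \<lhd> b) \<lhd> c = (a \<lhd> c) \<lhd> (b \<lhd> c)"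
    and rhd_rhd_inv: "a \<in> Q \<Longrightarrow> b \<in> Q \<Longrightarrow> (a \<lhd> b) \<lhd>\<^sup>~ b = a"
    and rhd_inv_rhd: "a \<in> Q \<Longrightarrow> b \<in> Q \<Longrightarrow> (a \<lhd>\<^sup>~ b) \<lhd> b = a"
    and idem: "a \<in> Q \<Longrightarrow> a \<lhd> a = a"
begin

definition rhd_sgn :: "int \<Rightarrow> 'q \<Rightarrow> 'q \<Rightarrow> 'q" where
  "rhd_sgn e a b = (if e = 1 then a \<lhd> b else a \<lhd>\<^sup>~ b)"

primrec iterated_rhd :: "(nat \<Rightarrow> int) \<Rightarrow> (nat \<Rightarrow> 'q) \<Rightarrow> 'q \<Rightarrow> nat \<Rightarrow> 'q" where
  "iterated_rhd e c a 0 = a"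
| "iterated_rhd e c a (Suc m) = rhd_sgn (e (Suc m)) (iterated_rhd e c a m) (c (Suc m))"

definition positive_cocycle :: "('q \<Rightarrow> 'q \<Rightarrow> 'a::ab_group_add) \<Rightarrow> bool" where
  "positive_cocycle w \<longleftrightarrow>
     (\<forall>a\<in>Q. w a a = 0) \<and>
     (\<forall>a\<in>Q. \<forall>b\<in>Q. \<forall>c\<in>Q.
        w a c + w (a \<lhd> b) c = w (a \<lhd> c) (b \<lhd> c) + w a b + (w b c + w b c))"

end

definition has_order :: "'a::ab_group_add \<Rightarrow> nat \<Rightarrow> bool" where
  "has_order a n \<longleftrightarrow> n > 0 \<and> (\<Sum>i<n. a) = 0 \<and> (\<forall>m. 0 < m \<and> m < n \<longrightarrow> (\<Sum>i<m. a) \<noteq> 0)"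


section \<open>Oriented link diagrams in the plane\<close>

text \<open>
  The plane is the complex plane with its usual orientation.  A diagram with \<open>n\<close> components is a
  generic \<open>C\<^sup>1\<close> immersion of \<open>n\<close> oriented circles together with over/under information at the
  double points.  The source is the disjoint union of \<open>n\<close> copies of the unit circle, realised as
  \<open>{..<n} \<times> sphere 0 1\<close> (the index carries the discrete topology), each circle being traversed
  counterclockwise.  The set \<open>under\<close> consists of the parameters of the undercrossings: it selects
  the lower one of the two preimages of every double point.
\<close>

type_synonym param = "nat \<times> complex"

record diagram =
  components_no :: nat
  curve :: "param \<Rightarrow> complex"
  under :: "param set"

definition params :: "diagram \<Rightarrow> param set" where
  "params D = {..<components_no D} \<times> sphere 0 1"

definition travel :: "param \<Rightarrow> real \<Rightarrow> param" where
  "travel x t = (fst x, snd x * cis t)"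

definition velocity :: "diagram \<Rightarrow> param \<Rightarrow> complex" where
  "velocity D x = vector_derivative (\<lambda>t. curve D (travel x t)) (at 0)"

text \<open>The oriented area \<open>det (v, w)\<close>; it is positive iff \<open>w\<close> points to the left of \<open>v\<close>.\<close>

definition cross :: "complex \<Rightarrow> complex \<Rightarrow> real" where
  "cross v w = Re v * Im w - Im v * Re w"

definition double_params :: "diagram \<Rightarrow> param set" where
  "double_params D = {x \<in> params D. \<exists>y \<in> params D. y \<noteq> x \<and> curve D y = curve D x}"

definition link_diagram :: "diagram \<Rightarrow> bool" where
  "link_diagram D \<longleftrightarrow>
     (\<forall>x \<in> params D. (\<lambda>t. curve D (travel x t)) differentiable (at 0)) \<and>
     continuous_on (params D) (velocity D) \<and>
     (\<forall>x \<in> params D. velocity D x \<noteq> 0) \<and>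
     finite (double_params D) \<and>
     (\<forall>x \<in> params D. \<forall>y \<in> params D. \<forall>z \<in> params D.
        curve D x = curve D y \<and> curve D y = curve D z \<longrightarrow> x = y \<or> y = z \<or> x = z) \<and>
     (\<forall>x \<in> params D. \<forall>y \<in> params D. x \<noteq> y \<and> curve D x = curve D y \<longrightarrow>
        cross (velocity D x) (velocity D y) \<noteq> 0) \<and>
     under D \<subseteq> double_params D \<and>
     (\<forall>x \<in> params D. \<forall>y \<in> params D. x \<noteq> y \<and> curve D x = curve D y \<longrightarrow>
        (x \<in> under D \<longleftrightarrow> y \<notin> under D))"

text \<open>A crossing is given by the parameter of its over-strand and that of its under-strand.\<close>

definition crossings :: "diagram \<Rightarrow> (param \<times> param) set" where
  "crossings D = {(p, u). p \<in> params D \<and> u \<in> under D \<and> p \<noteq> u \<and> curve D p = curve D u}"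


subsection \<open>Arcs and colorings\<close>

text \<open>
  Arcs are taken in the source rather than in the plane, so that an over-strand is not cut
  at its crossings.
\<close>

definition arcs :: "diagram \<Rightarrow> param set set" where
  "arcs D = components (params D - under D)"

definition over_arc :: "diagram \<Rightarrow> param \<times> param \<Rightarrow> param set" where
  "over_arc D x = (THE A. A \<in> arcs D \<and> fst x \<in> A)"

definition outgoing_arc :: "diagram \<Rightarrow> param \<Rightarrow> param set" where
  "outgoing_arc D u = (THE A. A \<in> arcs D \<and> (\<forall>\<^sub>F t in at_right 0. travel u t \<in> A))"

definition incoming_arc :: "diagram \<Rightarrow> param \<Rightarrow> param set" where
  "incoming_arc D u = (THE A. A \<in> arcs D \<and> (\<forall>\<^sub>F t in at_left 0. travel u t \<in> A))"

text \<open>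
  If the under-strand crosses the over-strand from right to left, i.e. the velocity of the
  under-strand points to the left of the over-strand, then the incoming under-arc is the one
  on the right of the over-arc.
\<close>

definition right_under_arc :: "diagram \<Rightarrow> param \<times> param \<Rightarrow> param set" where
  "right_under_arc D x =
     (if cross (velocity D (fst x)) (velocity D (snd x)) > 0
      then incoming_arc D (snd x) else outgoing_arc D (snd x))"

definition left_under_arc :: "diagram \<Rightarrow> param \<times> param \<Rightarrow> param set" where
  "left_under_arc D x =
     (if cross (velocity D (fst x)) (velocity D (snd x)) > 0
      then outgoing_arc D (snd x) else incoming_arc D (snd x))"

definition (in quandle) coloring :: "diagram \<Rightarrow> (param set \<Rightarrow> 'q) \<Rightarrow> bool" where
  "coloring D col \<longleftrightarrow>
     (\<forall>A \<in> arcs D. col A \<in> Q) \<and>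
     (\<forall>x \<in> crossings D. col (left_under_arc D x) = col (right_under_arc D x) \<lhd> col (over_arc D x))"


subsection \<open>Regions and the checkerboard coloring\<close>

definition regions :: "diagram \<Rightarrow> complex set set" where
  "regions D = components (- curve D ` params D)"

definition region_towards :: "diagram \<Rightarrow> complex \<Rightarrow> complex \<Rightarrow> complex set \<Rightarrow> bool" where
  "region_towards D p w R \<longleftrightarrow>
     R \<in> regions D \<and> (\<forall>\<^sub>F t in at_right 0. p + complex_of_real t * w \<in> R)"

text \<open>
  The set of black regions of the checkerboard coloring: the exterior is white, and the regions
  on the left and on the right of any edge have different colors.  Every diagram has exactly one
  such coloring, so this predicate determines \<open>black\<close>.
\<close>

definition checkerboard :: "diagram \<Rightarrow> complex set set \<Rightarrow> bool" where
  "checkerboard D black \<longleftrightarrow>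
     black \<subseteq> regions D \<and>
     (\<forall>R \<in> regions D. \<not> bounded R \<longrightarrow> R \<notin> black) \<and>
     (\<forall>x \<in> params D - double_params D. \<forall>L R.
        region_towards D (curve D x) (\<i> * velocity D x) L \<and>
        region_towards D (curve D x) (- \<i> * velocity D x) R \<longrightarrow>
        (L \<in> black \<longleftrightarrow> R \<notin> black))"

text \<open>
  The directions passed by the line through \<open>v\<close>, rotated counterclockwise, before it first
  becomes parallel to \<open>w\<close>.  The sign \<open>s\<close> accounts for the two halves of the line.
\<close>

definition swept_directions :: "complex \<Rightarrow> complex \<Rightarrow> complex set" where
  "swept_directions v w =
     {complex_of_real s * v * cis \<theta> | s \<theta>.
        s \<in> {1, -1} \<and> 0 < \<theta> \<and> (\<forall>\<phi> \<in> {0<..\<theta>}. cross (v * cis \<phi>) w \<noteq> 0)}"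

definition swept_regions :: "diagram \<Rightarrow> param \<times> param \<Rightarrow> complex set set" where
  "swept_regions D x =
     {R. \<exists>d \<in> swept_directions (velocity D (fst x)) (velocity D (snd x)).
           region_towards D (curve D (fst x)) d R}"


subsection \<open>The positive weight\<close>

text \<open>For a checkerboard coloring the swept regions are either all black or all white, so the
  value \<open>-1\<close> is taken exactly when they are white.\<close>

definition eps_pos :: "diagram \<Rightarrow> complex set set \<Rightarrow> param \<times> param \<Rightarrow> int" where
  "eps_pos D black x = (if swept_regions D x \<subseteq> black then 1 else -1)"

definition pos_weight ::
    "diagram \<Rightarrow> complex set set \<Rightarrow> (param set \<Rightarrow> 'q) \<Rightarrow> ('q \<Rightarrow> 'q \<Rightarrow> 'a::ab_group_add) \<Rightarrow> 'a" where
  "pos_weight D black col w =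
     (\<Sum>x \<in> crossings D.
        let v = w (col (right_under_arc D x)) (col (over_arc D x))
        in if eps_pos D black x = 1 then v else - v)"

end

theory Submission
  imports Defs
begin

text \<open>
  Summing the cocycle identity over the crossings shows that replacing a coloring \<open>\<C>\<close> by
  \<open>\<C> \<lhd> c\<close> changes the sign of the positive weight, provided that the sum of
  \<open>\<epsilon>(x) (2 f(b) - f(a) - f(a \<lhd> b))\<close> over the crossings vanishes for \<open>f = \<omega>(\<cdot>, c)\<close>.  Give
  each point of the link that is not a double point the value \<open>f\<close> of the color of its arc, with
  sign \<open>+\<close> if the region on its left is black and \<open>-\<close> if it is white.  The summand at \<open>x\<close> is
  the total jump of this piecewise constant function at the two preimages of \<open>x\<close>, and the jumps
  along a circle add up to zero.  An odd number of translations that restores the coloring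
  therefore shows that the weight equals its negative.

  Only the local behavior of the regions along a strand enters, no global separation theorem: the
  existence of a checkerboard coloring is a hypothesis.
\<close>

section \<open>Quandle colorings\<close>

text \<open>The jumps fit the cocycle identity because the four quadrants at a crossing alternate in
  color. The over-strand keeps its arc while the color on its left changes, so its jump is
  \<open>2 f(b)\<close> up to the sign of the crossing. On the under-strand both color and arc
  change: the term of the incoming arc has the sign of the crossing, that of the outgoing arc the
  opposite one. The jump is therefore minus the sum of both terms, which is symmetric in the two
  under-arcs, so the direction in which the under-strand crosses does not matter. The work lies in
  relating the quadrants, which are sets of directions at the crossing, to the regions beside points
  shortly before and after it. No local straightening of the curves is used: cones and short
  segments are shown to miss the strands through the crossing by first-order estimates with
  \<open>cross\<close>, and compactness keeps the rest of the diagram away.\<close>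

context quandle
begin

text \<open>Translation by \<open>c\<close> is a bijective endomorphism of \<open>Q\<close>, so its
  inverse is an endomorphism too: both sides become \<open>a \<lhd> b\<close> after translation by
  \<open>c\<close>.\<close>

lemma rhd_inv_distrib:
  assumes "a \<in> Q" "b \<in> Q" "c \<in> Q"
  shows "(a \<lhd> b) \<lhd>\<^sup>~ c = (a \<lhd>\<^sup>~ c) \<lhd> (b \<lhd>\<^sup>~ c)"
proof -
  have "((a \<lhd>\<^sup>~ c) \<lhd> (b \<lhd>\<^sup>~ c)) \<lhd> c = a \<lhd> b"
    using self_distrib[of "a \<lhd>\<^sup>~ c" "b \<lhd>\<^sup>~ c" c] assms by (simp add: rhd_inv_rhd closed_inv)
  then have "(a \<lhd> b) \<lhd>\<^sup>~ c = (((a \<lhd>\<^sup>~ c) \<lhd> (b \<lhd>\<^sup>~ c)) \<lhd> c) \<lhd>\<^sup>~ c"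
    by simp
  also have "\<dots> = (a \<lhd>\<^sup>~ c) \<lhd> (b \<lhd>\<^sup>~ c)"
    using assms by (intro rhd_rhd_inv closed closed_inv)
  finally show ?thesis .
qed

lemma rhd_sgn_closed: "a \<in> Q \<Longrightarrow> b \<in> Q \<Longrightarrow> rhd_sgn e a b \<in> Q"
  by (simp add: rhd_sgn_def closed closed_inv)

lemma rhd_sgn_distrib:
  "a \<in> Q \<Longrightarrow> b \<in> Q \<Longrightarrow> c \<in> Q \<Longrightarrow> rhd_sgn e (a \<lhd> b) c = rhd_sgn e a c \<lhd> rhd_sgn e b c"
  by (simp add: rhd_sgn_def self_distrib rhd_inv_distrib)

end

section \<open>Total jump of a piecewise constant function\<close>

text \<open>Only the one-sided germs of \<open>H\<close> enter. Subtracting the jumps already passed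
  from the left germ leaves a locally constant function on a connected interval. The half-open range
  counts a jump at \<open>a\<close> but none at \<open>b\<close>, as is right for one turn around a
  circle.\<close>

lemma total_jump_interval:
  fixes H hp hm :: "real \<Rightarrow> 'a::ab_group_add"
  assumes right: "\<And>t. \<forall>\<^sub>F s in at_right t. H s = hp t"
    and left: "\<And>t. \<forall>\<^sub>F s in at_left t. H s = hm t"
    and S: "finite S" "S \<subseteq> {a..<b}"
    and cont: "\<And>t. t \<in> {a..<b} - S \<Longrightarrow> hp t = hm t"
    and "a \<le> b"
  shows "(\<Sum>t\<in>S. hp t - hm t) = hm b - hm a"
proof -
  \<comment> \<open>Only jumps strictly before \<open>t\<close> are subtracted, in keeping with the
    left germ \<open>hm\<close>, which does not yet see the jump at \<open>t\<close>.\<close>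
  define G where "G t = hm t - (\<Sum>s\<in>S \<inter> {..<t}. hp s - hm s)" for t
  \<comment> \<open>\<open>H\<close> is constant on a short interval to the right of
    \<open>t\<close>, so its left germ at every point of that interval is this constant.\<close>
  have hm_right: "\<forall>\<^sub>F s in at_right t. hm s = hp t" for t
  proof -
    obtain d where d: "d > t" "\<And>s. t < s \<Longrightarrow> s < d \<Longrightarrow> H s = hp t"
      using right[of t] by (auto simp: eventually_at_right_field)
    have "hm s = hp t" if s: "t < s" "s < d" for s
    proof -
      have "\<forall>\<^sub>F r in at_left s. r \<in> {t<..<s}"
        using s(1) by (rule eventually_at_left_real)
      with left[of s] have "\<forall>\<^sub>F r in at_left s. hm s = hp t"
        by eventually_elim (use d s in auto)
      then show ?thesis by simp
    qed
    then show ?thesis using d(1) by (auto simp: eventually_at_right_field)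
  qed
  have hm_left: "\<forall>\<^sub>F s in at_left t. hm s = hm t" for t
  proof -
    obtain d where d: "d < t" "\<And>s. d < s \<Longrightarrow> s < t \<Longrightarrow> H s = hm t"
      using left[of t] by (auto simp: eventually_at_left_field)
    have "hm s = hm t" if s: "d < s" "s < t" for s
    proof -
      have "\<forall>\<^sub>F r in at_left s. r \<in> {d<..<s}"
        using s(1) by (rule eventually_at_left_real)
      with left[of s] have "\<forall>\<^sub>F r in at_left s. hm s = hm t"
        by eventually_elim (use d s in auto)
      then show ?thesis by simp
    qed
    then show ?thesis using d(1) by (auto simp: eventually_at_left_field)
  qed
  have notin: "\<forall>\<^sub>F s in at t. s \<notin> S" for t :: real
    using islimpt_finite[OF S(1), of t] by (simp add: islimpt_iff_eventually)
  have "G a = G b"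
  proof (rule connected_local_const[of "{a..b}"])
    show "\<forall>t\<in>{a..b}. \<forall>\<^sub>F s in at t within {a..b}. G t = G s"
    proof
      fix t assume t: "t \<in> {a..b}"
      obtain d where d: "d > 0" "\<And>s. s \<noteq> t \<Longrightarrow> \<bar>s - t\<bar> < d \<Longrightarrow> s \<notin> S"
        using notin[of t] by (auto simp: eventually_at dist_real_def)
      have near_right: "\<forall>\<^sub>F s in at_right t. s < t + d"
        using d(1) eventually_at_right_real[of t "t + d"] by (auto elim: eventually_mono)
      have near_left: "\<forall>\<^sub>F s in at_left t. t - d < s"
        using d(1) eventually_at_left_real[of "t - d" t] by (auto elim: eventually_mono)
      \<comment> \<open>The restriction \<open>s \<le> b\<close> forces \<open>t < b\<close>, where
        \<open>hp\<close> and \<open>hm\<close> agree off \<open>S\<close>; at \<open>t = b\<close>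
        they may differ.\<close>
      have R: "\<forall>\<^sub>F s in at_right t. s \<le> b \<longrightarrow> G t = G s"
        using hm_right[of t] near_right eventually_at_right_less[of t]
      proof eventually_elim
        case (elim s)
        have eq: "S \<inter> {..<s} = S \<inter> {..<t} \<union> (S \<inter> {t})"
        proof (intro equalityI subsetI)
          fix r assume "r \<in> S \<inter> {..<s}"
          then show "r \<in> S \<inter> {..<t} \<union> (S \<inter> {t})" using d(2)[of r] elim by force
        qed (use elim in auto)
        have "(\<Sum>r\<in>S \<inter> {..<s}. hp r - hm r)
            = (\<Sum>r\<in>S \<inter> {..<t}. hp r - hm r) + (\<Sum>r\<in>S \<inter> {t}. hp r - hm r)"
          unfolding eq by (rule sum.union_disjoint) (use S in auto)
        moreover have "s \<le> b \<Longrightarrow> (\<Sum>r\<in>S \<inter> {t}. hp r - hm r) = hp t - hm t"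
          using cont[of t] t elim by (cases "t \<in> S") auto
        ultimately show ?case using elim by (auto simp: G_def algebra_simps)
      qed
      have L: "\<forall>\<^sub>F s in at_left t. G t = G s"
        using hm_left[of t] near_left eventually_at_left_real[of "t - 1" t, simplified]
      proof eventually_elim
        case (elim s)
        have "S \<inter> {..<s} = S \<inter> {..<t}"
        proof (intro equalityI subsetI)
          fix r assume "r \<in> S \<inter> {..<t}"
          then show "r \<in> S \<inter> {..<s}" using d(2)[of r] elim by force
        qed (use elim in auto)
        then show ?case using elim by (simp add: G_def)
      qed
      have "\<forall>\<^sub>F s in at t. s \<le> b \<longrightarrow> G t = G s"
        unfolding eventually_at_split using R L by (auto elim: eventually_mono)
      then show "\<forall>\<^sub>F s in at t within {a..b}. G t = G s"
        by (auto simp: eventually_at_filter elim: eventually_mono)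
    qed
  qed (use \<open>a \<le> b\<close> in auto)
  moreover have "S \<inter> {..<a} = {}" "S \<inter> {..<b} = S" using S(2) by auto
  ultimately show ?thesis by (simp add: G_def algebra_simps)
qed

section \<open>Strands meeting transversally\<close>

interpretation cross: bounded_bilinear cross
proof
  show "\<exists>K. \<forall>a b. norm (cross a b) \<le> norm a * norm b * K"
  proof (intro exI allI)
    fix a b
    have "cross a b = Im (cnj a * b)" by (simp add: cross_def)
    then show "norm (cross a b) \<le> norm a * norm b * 1"
      using abs_Im_le_cmod[of "cnj a * b"] by (simp add: norm_mult)
  qed
qed (auto simp: cross_def algebra_simps)

declare cross.zero_left [simp] cross.zero_right [simp]

lemma cross_self [simp]: "cross v v = 0"
  by (simp add: cross_def)

lemma cross_of_real_left [simp]: "cross (of_real r * v) w = r * cross v w"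
  and cross_of_real_right [simp]: "cross v (of_real r * w) = r * cross v w"
  by (auto simp: cross_def algebra_simps)

lemma cross_commute: "cross v w = - cross w v"
  by (simp add: cross_def)

lemma cross_ii: "cross v (\<i> * v) = (norm v)\<^sup>2"
  by (simp add: cross_def cmod_def power2_eq_square)

lemma difference_quotient_tendsto:
  assumes "(h has_vector_derivative u) (at (0::real))"
  shows "((\<lambda>r. (h r - h 0) /\<^sub>R r) \<longlongrightarrow> u) (at 0)"
proof -
  have "((\<lambda>r. (h r - h 0 - r *\<^sub>R u) /\<^sub>R \<bar>r\<bar>) \<longlongrightarrow> 0) (at 0)"
    using assms by (simp add: has_vector_derivative_def has_derivative_at_within)
  then have "((\<lambda>r. norm ((h r - h 0 - r *\<^sub>R u) /\<^sub>R \<bar>r\<bar>)) \<longlongrightarrow> 0) (at 0)"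
    by (rule tendsto_norm_zero)
  moreover have "\<forall>\<^sub>F r in at 0. norm ((h r - h 0 - r *\<^sub>R u) /\<^sub>R \<bar>r\<bar>)
      = norm ((h r - h 0) /\<^sub>R r - u)"
  proof (rule eventually_at_filter[THEN iffD2], intro always_eventually allI impI)
    fix r :: real assume "r \<noteq> 0"
    then have "(h r - h 0) /\<^sub>R r - u = (h r - h 0 - r *\<^sub>R u) /\<^sub>R r"
      by (simp add: scaleR_diff_right)
    then show "norm ((h r - h 0 - r *\<^sub>R u) /\<^sub>R \<bar>r\<bar>) = norm ((h r - h 0) /\<^sub>R r - u)"
      by (simp add: divide_inverse)
  qed
  ultimately have "((\<lambda>r. norm ((h r - h 0) /\<^sub>R r - u)) \<longlongrightarrow> 0) (at 0)"
    by (rule Lim_transform_eventually)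
  then show ?thesis
    by (simp add: LIM_zero_iff tendsto_norm_zero_iff)
qed

text \<open>Near its base point a strand stays in any given double cone around its tangent: the
  difference quotient tends to \<open>u\<close>, where \<open>cross u u = 0\<close>, and the
  inequality is homogeneous, so it passes from the quotient to the difference.\<close>

lemma strand_tangency:
  assumes h: "(h has_vector_derivative u) (at (0::real))" and "u \<noteq> 0" "\<kappa> > 0"
  shows "\<exists>\<eta>>0. \<forall>r. \<bar>r\<bar> < \<eta> \<longrightarrow> \<bar>cross u (h r - h 0)\<bar> \<le> \<kappa> * norm (h r - h 0)"
proof -
  let ?q = "\<lambda>r. (h r - h 0) /\<^sub>R r"
  have "((\<lambda>r. \<kappa> * norm (?q r) - \<bar>cross u (?q r)\<bar>) \<longlongrightarrow> \<kappa> * norm u - \<bar>cross u u\<bar>) (at 0)"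
    by (intro tendsto_intros cross.tendsto difference_quotient_tendsto[OF h])
  then have "\<forall>\<^sub>F r in at 0. 0 < \<kappa> * norm (?q r) - \<bar>cross u (?q r)\<bar>"
    by (rule order_tendstoD(1)) (use assms in auto)
  then obtain \<eta> where \<eta>: "\<eta> > 0"
    "\<And>r. r \<noteq> 0 \<Longrightarrow> \<bar>r\<bar> < \<eta> \<Longrightarrow> \<bar>cross u (?q r)\<bar> < \<kappa> * norm (?q r)"
    by (auto simp: eventually_at dist_real_def)
  have "\<bar>cross u (h r - h 0)\<bar> \<le> \<kappa> * norm (h r - h 0)" if "\<bar>r\<bar> < \<eta>" for r
  proof (cases "r = 0")
    case False
    have "\<bar>cross u (h r - h 0)\<bar> = \<bar>r\<bar> * \<bar>cross u (?q r)\<bar>"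
      using False by (simp add: cross.scaleR_right abs_mult)
    also have "\<dots> \<le> \<bar>r\<bar> * (\<kappa> * norm (?q r))"
      using \<eta>(2)[OF False that] by (intro mult_left_mono) auto
    also have "\<dots> = \<kappa> * norm (h r - h 0)"
      using False by simp
    finally show ?thesis .
  qed simp
  with \<eta>(1) show ?thesis by blast
qed

text \<open>With \<open>\<kappa>\<close> half of the critical ratio
  \<open>\<bar>cross u w\<bar> / norm w\<close>, directions near \<open>w\<close> lie outside the
  double cone that contains the strand. This is homogeneous in \<open>t\<close>, so \<open>t\<close>
  needs no upper bound.\<close>

lemma strand_avoids_cone:
  assumes h: "(h has_vector_derivative u) (at (0::real))" and tr: "cross u w \<noteq> 0"
  shows "\<exists>\<eta>>0. \<forall>r t w'. \<bar>r\<bar> < \<eta> \<and> 0 < t \<and> dist w' w < \<eta> \<longrightarrow> h 0 + of_real t * w' \<noteq> h r"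
proof -
  have nz: "u \<noteq> 0" "w \<noteq> 0" using tr by auto
  define \<kappa> where "\<kappa> = \<bar>cross u w\<bar> / (2 * norm w)"
  have \<kappa>: "\<kappa> > 0" "\<kappa> * norm w < \<bar>cross u w\<bar>" using tr nz by (auto simp: \<kappa>_def)
  obtain \<eta>1 where \<eta>1: "\<eta>1 > 0"
    "\<And>r. \<bar>r\<bar> < \<eta>1 \<Longrightarrow> \<bar>cross u (h r - h 0)\<bar> \<le> \<kappa> * norm (h r - h 0)"
    using strand_tangency[OF h nz(1) \<kappa>(1)] by blast
  have "((\<lambda>w'. \<bar>cross u w'\<bar> - \<kappa> * norm w') \<longlongrightarrow> \<bar>cross u w\<bar> - \<kappa> * norm w) (nhds w)"
    by (intro tendsto_intros cross.tendsto filterlim_ident)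
  then have "\<forall>\<^sub>F w' in nhds w. 0 < \<bar>cross u w'\<bar> - \<kappa> * norm w'"
    by (rule order_tendstoD(1)) (use \<kappa> in auto)
  then obtain \<eta>2 where \<eta>2: "\<eta>2 > 0"
    "\<And>w'. dist w' w < \<eta>2 \<Longrightarrow> \<kappa> * norm w' < \<bar>cross u w'\<bar>"
    by (auto simp: eventually_nhds_metric)
  have "h 0 + of_real t * w' \<noteq> h r"
    if "\<bar>r\<bar> < min \<eta>1 \<eta>2" "0 < t" "dist w' w < min \<eta>1 \<eta>2" for r t w'
  proof
    assume "h 0 + of_real t * w' = h r"
    then have "h r - h 0 = of_real t * w'" by (simp add: algebra_simps)
    then have "t * \<bar>cross u w'\<bar> \<le> \<kappa> * (t * norm w')"
      using \<eta>1(2)[of r] that by (simp add: abs_mult norm_mult)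
    then have "t * \<bar>cross u w'\<bar> \<le> t * (\<kappa> * norm w')"
      by (simp only: mult.left_commute)
    then show False using \<eta>2(2)[of w'] that by simp
  qed
  then show ?thesis using \<eta>1(1) \<eta>2(1) by (intro exI[of _ "min \<eta>1 \<eta>2"]) auto
qed

text \<open>A push along \<open>w\<close> leaves \<open>cross (g t) w\<close> unchanged, while by
  the mean value theorem this function is injective near 0. Continuity of the derivative keeps it
  nonzero on a whole interval.\<close>

lemma strand_avoids_transverse_push:
  assumes g: "\<And>t. (g has_vector_derivative g' t) (at (t::real))"
    and g': "isCont g' 0" and tr: "cross (g' 0) w \<noteq> 0"
  shows "\<exists>\<eta>>0. \<forall>r t s. \<bar>r\<bar> < \<eta> \<and> \<bar>t\<bar> < \<eta> \<and> s \<noteq> 0 \<longrightarrow> g t + of_real s * w \<noteq> g r"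
proof -
  have "((\<lambda>t. cross (g' t) w) \<longlongrightarrow> cross (g' 0) w) (at 0)"
    using g' by (intro cross.tendsto tendsto_intros) (simp add: isCont_def)
  then have "\<forall>\<^sub>F t in at 0. cross (g' t) w \<noteq> 0"
    by (rule tendsto_imp_eventually_ne) (use tr in auto)
  then obtain \<eta> where \<eta>: "\<eta> > 0" "\<And>t. t \<noteq> 0 \<Longrightarrow> \<bar>t\<bar> < \<eta> \<Longrightarrow> cross (g' t) w \<noteq> 0"
    by (auto simp: eventually_at dist_real_def)
  have nz: "cross (g' t) w \<noteq> 0" if "\<bar>t\<bar> < \<eta>" for t
    using \<eta>(2)[of t] that tr by (cases "t = 0") auto
  have der: "((\<lambda>t. cross (g t) w) has_real_derivative cross (g' t) w) (at t)" for t
  proof -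
    have "((\<lambda>t. cross (g t) w) has_vector_derivative cross (g' t) w) (at t)"
      using bounded_linear.has_vector_derivative[OF cross.bounded_linear_left g] .
    then show ?thesis by (simp add: has_real_derivative_iff_has_vector_derivative)
  qed
  have inj: "cross (g t) w \<noteq> cross (g r) w" if tr_less: "t < r" "\<bar>t\<bar> < \<eta>" "\<bar>r\<bar> < \<eta>" for t r
  proof
    assume "cross (g t) w = cross (g r) w"
    then obtain z where z: "t < z" "z < r" "cross (g r) w - cross (g t) w = (r - t) * cross (g' z) w"
      using MVT2[OF tr_less(1), of "\<lambda>t. cross (g t) w" "\<lambda>t. cross (g' t) w"] der by blast
    then have "cross (g' z) w = 0"
      using \<open>cross (g t) w = cross (g r) w\<close> that(1) by auto
    moreover have "\<bar>z\<bar> < \<eta>" using z that by auto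
    ultimately show False using nz by blast
  qed
  have "g t + of_real s * w \<noteq> g r" if "\<bar>r\<bar> < \<eta>" "\<bar>t\<bar> < \<eta>" "s \<noteq> 0" for r t s
  proof
    assume eq: "g t + of_real s * w = g r"
    then have "cross (g r) w = cross (g t) w"
      by (metis add.right_neutral cross.add_left cross_of_real_left cross_self mult_zero_right)
    then have "r = t" using inj[of t r] inj[of r t] that by (metis linorder_neqE)
    then have "w = 0" using eq that by simp
    then show False using tr by simp
  qed
  then show ?thesis using \<eta>(1) by blast
qed

text \<open>Since \<open>w\<close> is parallel to \<open>u\<close>, the push does not change the
  distance to the tangent of \<open>h\<close>, which grows linearly in \<open>\<bar>t\<bar>\<close>.
  A common point would force it below \<open>\<kappa>\<close> times the displacement, and
  \<open>s \<le> \<bar>t\<bar>\<close> keeps the displacement linear in \<open>\<bar>t\<bar>\<close>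
  as well.\<close>

lemma crossing_strand_avoids_push:
  assumes g: "(g has_vector_derivative v) (at (0::real))"
    and h: "(h has_vector_derivative u) (at (0::real))"
    and "g 0 = h 0" and uv: "cross u v \<noteq> 0" and uw: "cross u w = 0"
  shows "\<exists>\<eta>>0. \<forall>r t s. \<bar>r\<bar> < \<eta> \<and> 0 < \<bar>t\<bar> \<and> \<bar>t\<bar> < \<eta> \<and> 0 \<le> s \<and> s \<le> \<bar>t\<bar>
            \<longrightarrow> g t + of_real s * w \<noteq> h r"
proof -
  have nz: "u \<noteq> 0" "v \<noteq> 0" using uv by auto
  let ?q = "\<lambda>t. (g t - g 0) /\<^sub>R t"
  obtain m where m: "m = norm v + norm w" "m > 0" using nz by (simp add: add_pos_nonneg)
  \<comment> \<open>Half of the critical ratio: \<open>m\<close> is the limit of the bound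
    \<open>norm (?q t) + norm w\<close> on the displacement divided by
    \<open>\<bar>t\<bar>\<close>.\<close>
  define \<kappa> where "\<kappa> = \<bar>cross u v\<bar> / (2 * m)"
  have \<kappa>: "\<kappa> > 0" using uv m(2) by (simp add: \<kappa>_def)
  have "\<kappa> * (norm v + norm w) = \<bar>cross u v\<bar> / 2"
    unfolding m(1)[symmetric] using m(2) by (simp add: \<kappa>_def)
  then have \<kappa>2: "\<kappa> * (norm v + norm w) < \<bar>cross u v\<bar>" using uv by simp
  obtain \<eta>1 where \<eta>1: "\<eta>1 > 0"
    "\<And>r. \<bar>r\<bar> < \<eta>1 \<Longrightarrow> \<bar>cross u (h r - h 0)\<bar> \<le> \<kappa> * norm (h r - h 0)"
    using strand_tangency[OF h nz(1) \<kappa>(1)] by blast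
  have "((\<lambda>t. \<bar>cross u (?q t)\<bar> - \<kappa> * (norm (?q t) + norm w)) \<longlongrightarrow>
      \<bar>cross u v\<bar> - \<kappa> * (norm v + norm w)) (at 0)"
    by (intro tendsto_intros cross.tendsto difference_quotient_tendsto[OF g])
  then have "\<forall>\<^sub>F t in at 0. 0 < \<bar>cross u (?q t)\<bar> - \<kappa> * (norm (?q t) + norm w)"
    by (rule order_tendstoD(1)) (use \<kappa>2 in auto)
  then obtain \<eta>2 where \<eta>2: "\<eta>2 > 0"
    "\<And>t. t \<noteq> 0 \<Longrightarrow> \<bar>t\<bar> < \<eta>2 \<Longrightarrow> \<kappa> * (norm (?q t) + norm w) < \<bar>cross u (?q t)\<bar>"
    by (auto simp: eventually_at dist_real_def)
  have "g t + of_real s * w \<noteq> h r"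
    if *: "\<bar>r\<bar> < min \<eta>1 \<eta>2" "0 < \<bar>t\<bar>" "\<bar>t\<bar> < min \<eta>1 \<eta>2" "0 \<le> s" "s \<le> \<bar>t\<bar>" for r t s
  proof
    assume "g t + of_real s * w = h r"
    then have eq: "h r - h 0 = (g t - g 0) + of_real s * w"
      using \<open>g 0 = h 0\<close> by (simp add: algebra_simps)
    define Q where "Q = ?q t"
    have gt: "g t - g 0 = of_real t * Q"
      using * by (simp add: Q_def scaleR_conv_of_real)
    have "\<bar>t\<bar> * \<bar>cross u (Q)\<bar> = \<bar>cross u (h r - h 0)\<bar>"
      unfolding eq gt by (simp add: cross.add_right uw abs_mult)
    also have "\<dots> \<le> \<kappa> * norm (h r - h 0)"
      using \<eta>1(2) * by simp
    also have "norm (h r - h 0) \<le> \<bar>t\<bar> * norm (Q) + s * norm w"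
      unfolding eq gt by (rule order_trans[OF norm_triangle_ineq]) (use * in \<open>simp add: norm_mult\<close>)
    also have "\<dots> \<le> \<bar>t\<bar> * (norm (Q) + norm w)"
      using mult_right_mono[OF *(5), of "norm w"] by (simp add: distrib_left)
    finally have "\<bar>t\<bar> * \<bar>cross u (Q)\<bar> \<le> \<bar>t\<bar> * (\<kappa> * (norm (Q) + norm w))"
      using \<kappa> by (simp add: mult_ac)
    then have "\<bar>cross u Q\<bar> \<le> \<kappa> * (norm Q + norm w)"
      using * by (simp only: mult_le_cancel_left_pos)
    then show False using \<eta>2(2)[of t] * unfolding Q_def by linarith
  qed
  then show ?thesis using \<eta>1(1) \<eta>2(1) by (intro exI[of _ "min \<eta>1 \<eta>2"]) auto
qed

section \<open>Local structure of a diagram\<close>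

lemma travel_0 [simp]: "travel x 0 = x"
  by (simp add: travel_def)

lemma travel_travel [simp]: "travel (travel x s) t = travel x (s + t)"
  by (simp add: travel_def cis_mult mult.assoc)

lemma travel_in_params [simp]: "travel x t \<in> params D \<longleftrightarrow> x \<in> params D"
  by (auto simp: travel_def params_def norm_mult mem_Times_iff)

lemma continuous_on_travel: "continuous_on A (travel x)"
proof -
  have "travel x = (\<lambda>t. (fst x, snd x * exp (\<i> * of_real t)))"
    by (simp add: fun_eq_iff travel_def cis_conv_exp)
  then show ?thesis by (auto intro!: continuous_intros)
qed

lemma continuous_travel: "isCont (travel x) t"
  using continuous_on_travel[of UNIV x] by (simp add: continuous_on_eq_continuous_at)

lemma params_eq_travel:
  assumes "x \<in> params D"
  obtains t where "t \<in> {0..<2 * pi}" "x = travel (fst x, 1) t"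
proof -
  have "norm (snd x) = 1" using assms by (auto simp: params_def)
  then have "snd x = cis (Arg2pi (snd x))"
    using Arg2pi_eq[of "snd x"] by (simp add: cis_conv_exp)
  moreover have "Arg2pi (snd x) \<in> {0..<2 * pi}"
    using Arg2pi_ge_0 Arg2pi_lt_2pi by simp
  ultimately show thesis by (intro that) (auto simp: travel_def prod_eq_iff)
qed

lemma eventually_travel_notin_finite:
  assumes "x \<in> params D" "finite X"
  shows "\<forall>\<^sub>F t in at 0. travel x t \<notin> X"
proof -
  have "\<forall>\<^sub>F t in at 0. travel x t \<noteq> y" for y
  proof (cases "y = x")
    \<comment> \<open>The limit is now \<open>y\<close> itself, so continuity does not separate the
      points; instead \<open>sin t \<noteq> 0\<close> for \<open>0 < \<bar>t\<bar> < pi\<close>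
      shows that the path does not return to \<open>x\<close>.\<close>
    case True
    have "travel x t \<noteq> x" if "t \<noteq> 0" "\<bar>t\<bar> < pi" for t
    proof
      assume "travel x t = x"
      moreover have "snd x \<noteq> 0" using assms(1) by (auto simp: params_def)
      ultimately have "cis t = 1" by (simp add: travel_def prod_eq_iff)
      then have "sin t = 0" by (simp add: complex_eq_iff)
      moreover have "sin t \<noteq> 0"
        using that sin_gt_zero[of t] sin_gt_zero[of "- t"] by (cases "t > 0") auto
      ultimately show False by simp
    qed
    then have "\<forall>\<^sub>F t in at 0. travel x t \<noteq> x"
      by (auto simp: eventually_at dist_real_def intro!: exI[of _ pi])
    then show ?thesis using True by simp
  next
    case False
    have "(travel x \<longlongrightarrow> x) (at 0)"
      using continuous_travel[where x = x and t = 0] by (simp add: isCont_def)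
    then show ?thesis by (rule tendsto_imp_eventually_ne) (use False in auto)
  qed
  then have "\<forall>\<^sub>F t in at 0. \<forall>y\<in>X. travel x t \<noteq> y"
    by (intro eventually_ball_finite[OF assms(2)]) auto
  then show ?thesis by eventually_elim auto
qed

lemma filterlim_signed_at_right:
  assumes "\<sigma> \<in> {1, -1 :: real}"
  shows "filterlim (\<lambda>t. \<sigma> * t) (at 0) (at_right 0)"
proof -
  have "((\<lambda>t. \<sigma> * t) \<longlongrightarrow> \<sigma> * 0) (at_right 0)" by (intro tendsto_intros)
  moreover have "\<forall>\<^sub>F t in at_right 0. \<sigma> * t \<noteq> 0"
    using eventually_at_right_less[of 0] by eventually_elim (use assms in auto)
  ultimately show ?thesis by (simp add: filterlim_at)
qed

lemma uniform_radius:
  assumes "finite F" "\<And>y. y \<in> F \<Longrightarrow> \<exists>\<eta>>0. P y (\<eta>::real)"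
    and "\<And>y \<eta> \<eta>'. P y \<eta> \<Longrightarrow> \<eta>' \<le> \<eta> \<Longrightarrow> P y \<eta>'"
  shows "\<exists>\<eta>>0. \<forall>y\<in>F. P y \<eta>"
  using assms(1,2)
proof (induction F)
  case empty
  then show ?case by (auto intro: exI[of _ 1])
next
  case (insert y F)
  then obtain \<eta> \<eta>' where "\<eta> > 0" "\<forall>y\<in>F. P y \<eta>" "\<eta>' > 0" "P y \<eta>'" by (metis insertCI)
  then show ?case using assms(3) by (intro exI[of _ "min \<eta> \<eta>'"]) (auto intro: min.cobounded1)
qed

text \<open>Transversality ensures that a short ray starts inside a single region; along a tangent,
  a \<open>C^1\<close> strand could meet the ray again and again.\<close>

definition transverse :: "diagram \<Rightarrow> complex \<Rightarrow> complex \<Rightarrow> bool" where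
  "transverse D p w \<longleftrightarrow> (\<forall>y\<in>params D. curve D y = p \<longrightarrow> cross (velocity D y) w \<noteq> 0)"

text \<open>At most one region lies in a given direction, so the existential names its color without
  a choice operator; it is false if the ray enters no region.\<close>

definition black_towards :: "diagram \<Rightarrow> complex set set \<Rightarrow> complex \<Rightarrow> complex \<Rightarrow> bool" where
  "black_towards D black p w \<longleftrightarrow> (\<exists>R\<in>black. region_towards D p w R)"

definition left_black :: "diagram \<Rightarrow> complex set set \<Rightarrow> param \<Rightarrow> bool" where
  "left_black D black x \<longleftrightarrow> black_towards D black (curve D x) (\<i> * velocity D x)"

lemma region_towards_unique:
  assumes "region_towards D p w R" "region_towards D p w R'"
  shows "R = R'"
proof -
  have "\<forall>\<^sub>F t in at_right 0. p + complex_of_real t * w \<in> R \<inter> R'"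
    using assms unfolding region_towards_def by (auto elim: eventually_elim2)
  then have "R \<inter> R' \<noteq> {}"
    using eventually_happens[of _ "at_right (0::real)"] by fastforce
  then show ?thesis
    using assms components_eq unfolding region_towards_def regions_def by blast
qed

locale oriented_link =
  fixes D :: diagram
  assumes diagram: "link_diagram D"
begin

text \<open>\<open>velocity\<close> is a derivative at time 0 from each base parameter; moving the
  base point to \<open>travel x t\<close> turns it into the derivative at time
  \<open>t\<close>.\<close>

lemma strand_has_vector_derivative:
  assumes "x \<in> params D"
  shows "((\<lambda>t. curve D (travel x t)) has_vector_derivative velocity D (travel x t)) (at t)"
proof -
  let ?y = "travel x t"
  have "(\<lambda>s. curve D (travel ?y s)) differentiable (at 0)"
    using diagram assms unfolding link_diagram_def by (simp del: travel_travel)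
  then have "((\<lambda>s. curve D (travel ?y s)) has_vector_derivative velocity D ?y) (at 0)"
    unfolding velocity_def vector_derivative_works .
  moreover have "((\<lambda>s. s - t) has_vector_derivative 1) (at t)"
    by (auto intro!: derivative_eq_intros)
  ultimately have "((\<lambda>s. curve D (travel ?y s)) \<circ> (\<lambda>s. s - t) has_vector_derivative 1 *\<^sub>R velocity D ?y) (at t)"
    by (intro vector_diff_chain_at) auto
  then show ?thesis by (simp add: o_def)
qed

lemma continuous_strand: "x \<in> params D \<Longrightarrow> isCont (\<lambda>t. curve D (travel x t)) t"
  using strand_has_vector_derivative has_vector_derivative_continuous by blast

lemma continuous_velocity:
  assumes "x \<in> params D"
  shows "isCont (\<lambda>t. velocity D (travel x t)) t"
proof -
  have "continuous_on (params D) (velocity D)"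
    using diagram by (simp add: link_diagram_def)
  then have "continuous_on UNIV (\<lambda>t. velocity D (travel x t))"
    by (rule continuous_on_compose2[OF _ continuous_on_travel]) (use assms in auto)
  then show ?thesis by (simp add: continuous_on_eq_continuous_at)
qed

lemma velocity_nonzero: "x \<in> params D \<Longrightarrow> velocity D x \<noteq> 0"
  using diagram by (simp add: link_diagram_def)

lemma crossing_transverse:
  "x \<in> params D \<Longrightarrow> y \<in> params D \<Longrightarrow> x \<noteq> y \<Longrightarrow> curve D x = curve D y \<Longrightarrow>
   cross (velocity D x) (velocity D y) \<noteq> 0"
  using diagram by (simp add: link_diagram_def)

lemma finite_double_params: "finite (double_params D)"
  using diagram by (simp add: link_diagram_def)

lemma finite_fiber: "finite {y \<in> params D. curve D y = p}"
proof (cases "\<exists>x\<in>params D. curve D x = p")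
  case True
  then obtain x where x: "x \<in> params D" "curve D x = p" by blast
  have "{y \<in> params D. curve D y = p} \<subseteq> insert x (double_params D)"
  proof
    fix y assume "y \<in> {y \<in> params D. curve D y = p}"
    then show "y \<in> insert x (double_params D)"
      using x by (cases "y = x") (auto simp: double_params_def intro!: bexI[of _ x])
  qed
  then show ?thesis using finite_double_params by (meson finite_insert finite_subset)
next
  case False
  then have "{y \<in> params D. curve D y = p} = {}" by auto
  then show ?thesis by (metis finite.emptyI)
qed

text \<open>Compactness: the parameters away from the fiber over \<open>p\<close> have a compact
  image that misses \<open>p\<close>. For an empty fiber this says that the diagram keeps a distance
  from \<open>p\<close>.\<close>

lemma curve_near:
  assumes "\<eta> > 0"
  shows "\<exists>\<rho>>0. \<forall>z\<in>params D. dist (curve D z) p < \<rho> \<longrightarrow>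
           (\<exists>y\<in>params D. curve D y = p \<and> (\<exists>r. \<bar>r\<bar> < \<eta> \<and> z = travel y r))"
proof -
  define g where "g i t = curve D (travel (i, 1) t)" for i t
  define V where "V i = (\<Union>t0\<in>{t0. g i t0 = p}. ball t0 \<eta>)" for i
  define C where "C = (\<Union>i<components_no D. g i ` ({0..2 * pi} - V i))"
  have "compact (g i ` ({0..2 * pi} - V i))" if "i < components_no D" for i
  proof (rule compact_continuous_image)
    have "(i, 1) \<in> params D" using that by (simp add: params_def)
    then show "continuous_on ({0..2 * pi} - V i) (g i)"
      unfolding g_def using continuous_strand by (intro continuous_at_imp_continuous_on) auto
    show "compact ({0..2 * pi} - V i)"
      by (intro compact_diff) (auto simp: V_def)
  qed
  then have "closed C" unfolding C_def by (intro closed_UN compact_imp_closed) auto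
  moreover have "p \<notin> C"
    using assms by (force simp: C_def V_def)
  ultimately obtain \<rho> where \<rho>: "\<rho> > 0" "ball p \<rho> \<subseteq> - C"
    by (metis ComplI open_Compl open_contains_ball)
  have "\<exists>y\<in>params D. curve D y = p \<and> (\<exists>r. \<bar>r\<bar> < \<eta> \<and> z = travel y r)"
    if z: "z \<in> params D" "dist (curve D z) p < \<rho>" for z
  proof -
    obtain t where t: "t \<in> {0..<2 * pi}" "z = travel (fst z, 1) t"
      using params_eq_travel[OF z(1)] .
    have i: "fst z < components_no D" using z(1) by (auto simp: params_def)
    have "g (fst z) t \<notin> C"
      using z(2) \<rho>(2) t(2) by (auto simp: g_def dist_commute)
    then have "t \<notin> {0..2 * pi} - V (fst z)" using i unfolding C_def by blast
    then have "t \<in> V (fst z)" using t(1) by auto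
    then obtain t0 where t0: "g (fst z) t0 = p" "\<bar>t0 - t\<bar> < \<eta>"
      by (auto simp: V_def dist_real_def)
    have "z = travel (travel (fst z, 1) t0) (t - t0)" using t(2) by simp
    moreover have "travel (fst z, 1) t0 \<in> params D"
      using i by (subst travel_in_params) (simp add: params_def)
    ultimately show ?thesis
      using t0 unfolding g_def by (intro bexI[of _ "travel (fst z, 1) t0"] conjI exI[of _ "t - t0"]) auto
  qed
  then show ?thesis using \<rho>(1) by blast
qed

text \<open>A short open cone around \<open>w\<close> with apex \<open>p\<close> misses the diagram,
  since near \<open>p\<close> only the strands through \<open>p\<close> occur and each of them
  avoids the cone. Being connected, the cone lies in one region.\<close>

lemma region_of_cone:
  assumes "transverse D p w"
  shows "\<exists>R\<in>regions D. \<exists>\<eta>>0. \<forall>t w'. 0 < t \<and> t < \<eta> \<and> dist w' w < \<eta> \<longrightarrow> p + of_real t * w' \<in> R"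
proof -
  let ?F = "{y \<in> params D. curve D y = p}"
  define P where "P y \<eta> \<longleftrightarrow> (\<forall>r t w'. \<bar>r\<bar> < \<eta> \<and> 0 < t \<and> dist w' w < \<eta> \<longrightarrow>
      p + of_real t * w' \<noteq> curve D (travel y r))" for y \<eta>
  have "\<exists>\<eta>>0. \<forall>y\<in>?F. P y \<eta>"
  proof (rule uniform_radius[OF finite_fiber])
    fix y assume y: "y \<in> ?F"
    then have "cross (velocity D (travel y 0)) w \<noteq> 0"
      using assms by (auto simp: transverse_def)
    from strand_avoids_cone[OF strand_has_vector_derivative this] y
    show "\<exists>\<eta>>0. P y \<eta>" unfolding P_def by auto
  next
    fix y \<eta> \<eta>' assume "P y \<eta>" "\<eta>' \<le> \<eta>"
    then show "P y \<eta>'" unfolding P_def by force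
  qed
  then obtain \<eta>0 where \<eta>0: "\<eta>0 > 0" "\<And>y. y \<in> ?F \<Longrightarrow> P y \<eta>0" by blast
  obtain \<rho> where \<rho>: "\<rho> > 0" "\<And>z. z \<in> params D \<Longrightarrow> dist (curve D z) p < \<rho> \<Longrightarrow>
      \<exists>y\<in>params D. curve D y = p \<and> (\<exists>r. \<bar>r\<bar> < \<eta>0 \<and> z = travel y r)"
    using curve_near[OF \<eta>0(1), of p] by blast
  \<comment> \<open>The bound 1 gives \<open>norm w' \<le> norm w + 1\<close>, and the last term
    then keeps the cone within distance \<open>\<rho>\<close> of \<open>p\<close>.\<close>
  define \<eta> where "\<eta> = min (min \<eta>0 1) (\<rho> / (norm w + 1))"
  have \<eta>: "\<eta> > 0" "\<eta> \<le> \<eta>0" "\<eta> \<le> 1" "\<eta> \<le> \<rho> / (norm w + 1)"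
    using \<eta>0(1) \<rho>(1) by (auto simp: \<eta>_def add_nonneg_pos)
  define N where "N = (\<lambda>(t, w'). p + of_real t * w') ` ({0<..<\<eta>} \<times> ball w \<eta>)"
  have "N \<subseteq> - curve D ` params D"
  proof
    fix a assume "a \<in> N"
    then obtain t w' where a: "a = p + of_real t * w'" "0 < t" "t < \<eta>" "dist w' w < \<eta>"
      by (auto simp: N_def dist_commute)
    have "norm w' \<le> norm w + 1"
      using a(4) \<eta>(3) norm_triangle_ineq2[of w' w] by (simp add: dist_norm)
    then have "t * norm w' \<le> t * (norm w + 1)" using a by (intro mult_left_mono) auto
    also have "\<dots> < \<rho>"
      using a(3) \<eta>(4) by (metis add_nonneg_pos less_le_trans norm_ge_zero pos_less_divide_eq zero_less_one)
    finally have "dist a p < \<rho>" using a by (simp add: dist_norm norm_mult)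
    show "a \<in> - curve D ` params D"
    proof
      assume "a \<in> curve D ` params D"
      then obtain z where z: "z \<in> params D" "a = curve D z" by blast
      then obtain y r where "y \<in> ?F" "\<bar>r\<bar> < \<eta>0" "z = travel y r"
        using \<rho>(2)[of z] \<open>dist a p < \<rho>\<close> by auto
      then show False using \<eta>0(2)[of y] a z \<eta>(2) unfolding P_def by force
    qed
  qed
  moreover have "connected N"
    unfolding N_def
    by (intro connected_continuous_image connected_Times)
       (auto simp: case_prod_unfold intro!: continuous_intros)
  moreover have "N \<noteq> {}" using \<eta>(1) by (auto simp: N_def)
  ultimately obtain R where "R \<in> regions D" "N \<subseteq> R"
    unfolding regions_def using exists_component_superset by (metis subset_empty)
  then show ?thesis
    using \<eta>(1) by (intro bexI[of _ R] exI[of _ \<eta>]) (force simp: N_def dist_commute)+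
qed

lemma region_towards_near:
  assumes "transverse D p w"
  shows "\<exists>R. \<forall>\<^sub>F w' in nhds w. region_towards D p w' R"
proof -
  obtain R \<eta> where R: "R \<in> regions D" "\<eta> > 0"
    "\<And>t w'. 0 < t \<Longrightarrow> t < \<eta> \<Longrightarrow> dist w' w < \<eta> \<Longrightarrow> p + of_real t * w' \<in> R"
    using region_of_cone[OF assms] by blast
  have "region_towards D p w' R" if "dist w' w < \<eta>" for w'
    unfolding region_towards_def
    using eventually_at_right_real[OF R(2)] R that by (auto elim!: eventually_mono)
  then show ?thesis using R(2) by (auto simp: eventually_nhds_metric)
qed

lemma region_towards_ex: "transverse D p w \<Longrightarrow> \<exists>R. region_towards D p w R"
  using region_towards_near eventually_nhds_x_imp_x by blast

text \<open>By \<open>region_towards_near\<close> the region that a direction points to is locally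
  constant among transverse directions, hence constant on a connected set of them.\<close>

lemma region_towards_sector:
  assumes "connected S" "\<And>w. w \<in> S \<Longrightarrow> transverse D p w" "w \<in> S" "w' \<in> S"
  shows "region_towards D p w R \<longleftrightarrow> region_towards D p w' R"
proof -
  have "{R. region_towards D p w R} = {R. region_towards D p w' R}"
  proof (rule connected_local_const[OF assms(1,3,4)], intro ballI)
    fix a assume "a \<in> S"
    then obtain R where R: "\<forall>\<^sub>F b in nhds a. region_towards D p b R"
      using region_towards_near assms(2) by blast
    then have "region_towards D p a R" by (rule eventually_nhds_x_imp_x)
    have "\<forall>\<^sub>F b in nhds a. {R. region_towards D p a R} = {R. region_towards D p b R}"
      using R by eventually_elim (use \<open>region_towards D p a R\<close> region_towards_unique in blast)
    then show "\<forall>\<^sub>F b in at a within S. {R. region_towards D p a R} = {R. region_towards D p b R}"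
      by (simp add: eventually_at_filter eventually_mono)
  qed
  then show ?thesis by blast
qed

text \<open>
  The segments from \<open>g t\<close> to \<open>g t + \<bar>t\<bar> w\<close> end in a cone around the direction \<open>\<sigma> v + w\<close>.  They
  miss the strand \<open>g\<close> because \<open>cross (g t) w\<close> is strictly monotone in \<open>t\<close>, and they miss a second
  strand at a crossing because they are parallel to its tangent; there \<open>w\<close> is chosen as \<open>\<plusminus>\<close> the
  velocity of that strand.
\<close>

lemma region_towards_push:
  assumes x: "x \<in> params D" and xw: "cross (velocity D x) w \<noteq> 0"
    and others: "\<And>y. y \<in> params D \<Longrightarrow> curve D y = curve D x \<Longrightarrow> y \<noteq> x \<Longrightarrow> cross (velocity D y) w = 0"
    and \<sigma>: "\<sigma> \<in> {1, -1 :: real}"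
  shows "\<exists>R. region_towards D (curve D x) (of_real \<sigma> * velocity D x + w) R \<and>
           (\<forall>\<^sub>F t in at_right 0. region_towards D (curve D (travel x (\<sigma> * t))) w R)"
proof -
  define p where "p = curve D x"
  define v where "v = velocity D x"
  define g where "g t = curve D (travel x t)" for t
  let ?F = "{y \<in> params D. curve D y = p} - {x}"
  have g0: "g 0 = p" by (simp add: g_def p_def)
  have other_cross: "cross (velocity D y) v \<noteq> 0" "cross (velocity D y) w = 0" if "y \<in> ?F" for y
    using that crossing_transverse[of y x] others[of y] x by (auto simp: p_def v_def)
  have trans: "transverse D p (of_real \<sigma> * v + w)"
    unfolding transverse_def
  proof (intro ballI impI)
    fix y assume y: "y \<in> params D" "curve D y = p"
    show "cross (velocity D y) (of_real \<sigma> * v + w) \<noteq> 0"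
    proof (cases "y = x")
      case True
      then show ?thesis using xw by (simp add: cross.add_right v_def)
    next
      case False
      then show ?thesis using other_cross[of y] y \<sigma> by (auto simp: cross.add_right)
    qed
  qed
  obtain R \<eta>1 where R: "R \<in> regions D" "\<eta>1 > 0"
    "\<And>t w'. 0 < t \<Longrightarrow> t < \<eta>1 \<Longrightarrow> dist w' (of_real \<sigma> * v + w) < \<eta>1 \<Longrightarrow> p + of_real t * w' \<in> R"
    using region_of_cone[OF trans] by blast
  have Rtow: "region_towards D p (of_real \<sigma> * v + w) R"
    unfolding region_towards_def
    using eventually_at_right_real[OF R(2)] R by (auto elim!: eventually_mono)
  have g_der: "(g has_vector_derivative velocity D (travel x t)) (at t)" for t
    unfolding g_def by (rule strand_has_vector_derivative[OF x])
  obtain \<eta>2 where \<eta>2: "\<eta>2 > 0"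
    "\<And>r t s. \<bar>r\<bar> < \<eta>2 \<Longrightarrow> \<bar>t\<bar> < \<eta>2 \<Longrightarrow> s \<noteq> 0 \<Longrightarrow> g t + of_real s * w \<noteq> g r"
    using strand_avoids_transverse_push[OF g_der continuous_velocity[OF x], of w] xw by auto
  define P where "P y \<eta> \<longleftrightarrow> (\<forall>r t s. \<bar>r\<bar> < \<eta> \<and> 0 < \<bar>t\<bar> \<and> \<bar>t\<bar> < \<eta> \<and> 0 \<le> s \<and> s \<le> \<bar>t\<bar>
      \<longrightarrow> g t + of_real s * w \<noteq> curve D (travel y r))" for y \<eta>
  have "\<exists>\<eta>>0. \<forall>y\<in>?F. P y \<eta>"
  proof (rule uniform_radius)
    show "finite ?F" using finite_fiber by auto
  next
    fix y assume y: "y \<in> ?F"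
    then have h: "((\<lambda>r. curve D (travel y r)) has_vector_derivative velocity D y) (at 0)"
      using strand_has_vector_derivative[of y 0] by simp
    have "(g has_vector_derivative v) (at 0)" using g_der[of 0] by (simp add: v_def)
    from crossing_strand_avoids_push[OF this h _ other_cross[OF y]] y g0
    show "\<exists>\<eta>>0. P y \<eta>" unfolding P_def by auto
  next
    fix y \<eta> \<eta>' assume "P y \<eta>" "\<eta>' \<le> \<eta>"
    then show "P y \<eta>'" unfolding P_def by force
  qed
  then obtain \<eta>3 where \<eta>3: "\<eta>3 > 0" "\<And>y. y \<in> ?F \<Longrightarrow> P y \<eta>3" by blast
  define \<eta>0 where "\<eta>0 = min \<eta>2 \<eta>3"
  have \<eta>0: "\<eta>0 > 0" using \<eta>2 \<eta>3 by (simp add: \<eta>0_def)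
  obtain \<rho> where \<rho>: "\<rho> > 0" "\<And>z. z \<in> params D \<Longrightarrow> dist (curve D z) p < \<rho> \<Longrightarrow>
      \<exists>y\<in>params D. curve D y = p \<and> (\<exists>r. \<bar>r\<bar> < \<eta>0 \<and> z = travel y r)"
    using curve_near[OF \<eta>0, of p] by blast
  define h where "h t = g (\<sigma> * t)" for t
  have h0: "h 0 = p" by (simp add: h_def g0)
  have h_der: "(h has_vector_derivative of_real \<sigma> * v) (at 0)"
  proof -
    have "((\<lambda>t. \<sigma> * t) has_vector_derivative \<sigma>) (at 0)"
      by (auto intro!: derivative_eq_intros)
    moreover have "(g has_vector_derivative v) (at (\<sigma> * 0))" using g_der[of 0] by (simp add: v_def)
    ultimately have "(g \<circ> (\<lambda>t. \<sigma> * t) has_vector_derivative \<sigma> *\<^sub>R v) (at 0)"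
      by (rule vector_diff_chain_at)
    then show ?thesis by (simp add: h_def[abs_def] o_def scaleR_conv_of_real[symmetric])
  qed
  have ev1: "\<forall>\<^sub>F t in at_right 0. dist ((h t - p) /\<^sub>R t + w) (of_real \<sigma> * v + w) < \<eta>1"
  proof -
    have "((\<lambda>t. (h t - p) /\<^sub>R t + w) \<longlongrightarrow> of_real \<sigma> * v + w) (at 0)"
      using difference_quotient_tendsto[OF h_der] unfolding h0 by (intro tendsto_intros)
    then have "\<forall>\<^sub>F t in at 0. dist ((h t - p) /\<^sub>R t + w) (of_real \<sigma> * v + w) < \<eta>1"
      using R(2) by (rule tendstoD)
    then show ?thesis by (simp add: eventually_at_split)
  qed
  have ev2: "\<forall>\<^sub>F t in at_right 0. norm (h t - p) + t * norm w < \<rho>"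
  proof -
    have "isCont h 0" using h_der has_vector_derivative_continuous by blast
    then have "(h \<longlongrightarrow> p) (at 0)" by (simp add: isCont_def h0)
    then have "((\<lambda>t. norm (h t - p) + t * norm w) \<longlongrightarrow> norm (p - p) + 0 * norm w) (at 0)"
      by (intro tendsto_intros)
    then have "\<forall>\<^sub>F t in at 0. norm (h t - p) + t * norm w < \<rho>"
      by (rule order_tendstoD(2)) (use \<rho> in auto)
    then show ?thesis by (simp add: eventually_at_split)
  qed
  have "\<forall>\<^sub>F t in at_right 0. t \<in> {0<..<min \<eta>0 \<eta>1}"
    by (rule eventually_at_right_real) (use \<eta>0 R in auto)
  with ev1 ev2 have "\<forall>\<^sub>F t in at_right 0. region_towards D (h t) w R"
  proof eventually_elim
    case (elim t)
    then have t: "0 < t" "t < \<eta>0" "t < \<eta>1" by auto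
    \<comment> \<open>The segment omits its base point, which lies on the diagram, and contains its
      far end, which lies in the cone belonging to \<open>R\<close>.\<close>
    define N where "N = (\<lambda>s. h t + of_real s * w) ` {0<..t}"
    have "N \<subseteq> - curve D ` params D"
    proof
      fix a assume "a \<in> N"
      then have "\<exists>s\<in>{0<..t}. a = h t + of_real s * w" unfolding N_def by blast
      then obtain s where "s \<in> {0<..t}" and a: "a = h t + of_real s * w" by (rule bexE)
      then have s: "a = h t + of_real s * w" "0 < s" "s \<le> t" by simp_all
      have "dist a p \<le> norm (h t - p) + norm (of_real s * w)"
        unfolding s(1) dist_norm using norm_triangle_ineq[of "h t - p" "of_real s * w"]
        by (simp add: algebra_simps)
      also have "\<dots> \<le> norm (h t - p) + t * norm w"
        using s by (simp add: norm_mult mult_right_mono)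
      finally have ap: "dist a p < \<rho>" using elim by simp
      show "a \<in> - curve D ` params D"
      proof
        assume "a \<in> curve D ` params D"
        then obtain z where z: "z \<in> params D" "a = curve D z" by blast
        then obtain y r where y: "y \<in> params D" "curve D y = p" "\<bar>r\<bar> < \<eta>0" "z = travel y r"
          using \<rho>(2)[of z] ap by auto
        have ts: "\<bar>\<sigma> * t\<bar> = t" using \<sigma> t by auto
        show False
        proof (cases "y = x")
          case True
          then have "g (\<sigma> * t) + of_real s * w = g r" using s z y by (simp add: h_def g_def)
          then show False using \<eta>2(2)[of r "\<sigma> * t" s] y t s ts by (simp add: \<eta>0_def)
        next
          case False
          then have "P y \<eta>3" using \<eta>3(2) y by auto
          moreover have "\<bar>r\<bar> < \<eta>3 \<and> 0 < \<bar>\<sigma> * t\<bar> \<and> \<bar>\<sigma> * t\<bar> < \<eta>3 \<and> 0 \<le> s \<and> s \<le> \<bar>\<sigma> * t\<bar>"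
            unfolding ts using y t s by (simp add: \<eta>0_def)
          ultimately have "g (\<sigma> * t) + of_real s * w \<noteq> curve D (travel y r)"
            unfolding P_def by blast
          then show False using s z y by (simp add: h_def)
        qed
      qed
    qed
    moreover have "connected N"
      unfolding N_def by (intro connected_continuous_image) (auto intro!: continuous_intros)
    moreover have "R \<inter> N \<noteq> {}"
    proof -
      have "p + of_real t * ((h t - p) /\<^sub>R t + w) \<in> R" using R(3) t elim by simp
      also have "p + of_real t * ((h t - p) /\<^sub>R t + w) = h t + of_real t * w"
        using t by (simp add: algebra_simps scaleR_conv_of_real)
      finally have "h t + of_real t * w \<in> R" .
      moreover have "h t + of_real t * w \<in> N" unfolding N_def by (rule image_eqI[of _ _ t]) (use t in auto)
      ultimately show ?thesis by blast
    qed
    ultimately have "N \<subseteq> R" using components_maximal[of R _ N] R(1) unfolding regions_def by blast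
    moreover have "h t + of_real s * w \<in> N" if "s \<in> {0<..<t}" for s
      unfolding N_def by (rule image_eqI[of _ _ s]) (use that in auto)
    ultimately have "\<forall>\<^sub>F s in at_right 0. h t + of_real s * w \<in> R"
      using eventually_mono[OF eventually_at_right_real[OF t(1)]] by (metis (lifting) subsetD)
    then show ?case
      unfolding region_towards_def using R(1) by simp
  qed
  then show ?thesis using Rtow unfolding p_def v_def h_def g_def by blast
qed

end

section \<open>Directions swept at a crossing and the sectors they fill\<close>

lemma convex_left_side: "convex {d. 0 < cross v d}"
proof -
  have "{d. 0 < cross v d} = cross v -` {0<..}" by auto
  then show ?thesis
    using convex_linear_vimage[OF bounded_linear.linear[OF cross.bounded_linear_right]] by simp
qed

lemma convex_right_side: "convex {d. 0 < cross d v}"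
proof -
  have "cross d v = cross (- v) d" for d by (simp add: cross_def)
  then show ?thesis using convex_left_side[of "- v"] by simp
qed

lemma cross_cis: "cross v (v * cis \<theta>) = (norm v)\<^sup>2 * sin \<theta>"
  unfolding cmod_power2 by (simp add: cross_def power2_eq_square algebra_simps)

lemma continuous_cross_cis: "continuous_on A (\<lambda>\<phi>. cross (v * cis \<phi>) u)"
  by (intro cross.continuous_on continuous_intros)

text \<open>Here \<open>u'\<close> is the one of \<open>u\<close> and \<open>- u\<close> on the left
  of \<open>v\<close>. During the rotation \<open>cross (v * cis \<phi>) u'\<close> starts positive
  and never vanishes, so it stays positive.\<close>

lemma swept_direction_in_sector:
  assumes vu: "0 < cross v u'" and u': "u' = u \<or> u' = - u" and d: "d \<in> swept_directions v u"
  obtains d' where "d = d' \<or> d = - d'" "0 < cross v d'" "0 < cross d' u'"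
proof -
  obtain s \<theta> where s: "s \<in> {1, -1}" "d = of_real s * v * cis \<theta>" "0 < \<theta>"
    and ne: "\<And>\<phi>. \<phi> \<in> {0<..\<theta>} \<Longrightarrow> cross (v * cis \<phi>) u \<noteq> 0"
    using d unfolding swept_directions_def by blast
  have ne': "cross (v * cis \<phi>) u' \<noteq> 0" if "0 \<le> \<phi>" "\<phi> \<le> \<theta>" for \<phi>
    using ne[of \<phi>] that vu u' by (cases "\<phi> = 0") (auto simp: cross.minus_right)
  have pos: "0 < cross (v * cis \<phi>) u'" if \<phi>: "0 \<le> \<phi>" "\<phi> \<le> \<theta>" for \<phi>
  proof (rule ccontr)
    assume "\<not> ?thesis"
    moreover have "0 \<le> cross (v * cis 0) u'" using vu by simp
    ultimately have "\<exists>x\<ge>0. x \<le> \<phi> \<and> cross (v * cis x) u' = 0"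
      using \<phi>(1) by (intro IVT2' continuous_cross_cis) auto
    then show False using ne' \<phi> by force
  qed
  \<comment> \<open>After half a turn the sign of \<open>cross\<close> would be reversed.\<close>
  have "\<theta> < pi"
  proof (rule ccontr)
    assume "\<not> \<theta> < pi"
    then have "0 < cross (v * cis pi) u'" by (intro pos) auto
    then show False using vu by (simp add: cross.minus_left)
  qed
  then have "0 < cross v (v * cis \<theta>)"
    using s(3) vu by (auto simp: cross_cis sin_gt_zero intro!: mult_pos_pos)
  then show thesis
    using s pos[of \<theta>] by (intro that[of "v * cis \<theta>"]) auto
qed

text \<open>Any small rotation will do. This keeps the inclusion in \<open>eps_pos\<close> from
  holding vacuously.\<close>

lemma swept_direction_exists:
  assumes vu: "0 < cross v u'" and u': "u' = u \<or> u' = - u"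
  obtains d where "d \<in> swept_directions v u" "0 < cross v d" "0 < cross d u'"
proof -
  have "isCont (\<lambda>\<phi>. cross (v * cis \<phi>) u') 0"
    using continuous_cross_cis[of UNIV v u'] by (simp add: continuous_on_eq_continuous_at)
  then have "((\<lambda>\<phi>. cross (v * cis \<phi>) u') \<longlongrightarrow> cross v u') (at 0)"
    by (simp add: isCont_def)
  then have "\<forall>\<^sub>F \<phi> in at 0. 0 < cross (v * cis \<phi>) u'"
    by (rule order_tendstoD(1)) (rule vu)
  then obtain \<delta> where \<delta>: "\<delta> > 0" "\<And>\<phi>. \<phi> \<noteq> 0 \<Longrightarrow> \<bar>\<phi>\<bar> < \<delta> \<Longrightarrow> 0 < cross (v * cis \<phi>) u'"
    by (auto simp: eventually_at dist_real_def)
  define \<theta> where "\<theta> = min (\<delta> / 2) 1"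
  have \<theta>: "0 < \<theta>" "\<theta> < \<delta>" "\<theta> < pi" using \<delta>(1) pi_gt3 by (auto simp: \<theta>_def)
  have "cross (v * cis \<phi>) u \<noteq> 0" if "\<phi> \<in> {0<..\<theta>}" for \<phi>
    using \<delta>(2)[of \<phi>] that \<theta> u' by (auto simp: cross.minus_right)
  then have "v * cis \<theta> \<in> swept_directions v u"
    using \<theta>(1) unfolding swept_directions_def by (intro CollectI exI[of _ 1] exI[of _ \<theta>]) auto
  moreover have "0 < cross v (v * cis \<theta>)"
    using \<theta> vu by (auto simp: cross_cis sin_gt_zero intro!: mult_pos_pos)
  ultimately show thesis using that \<delta>(2)[of \<theta>] \<theta> by auto
qed

lemma black_towards_iff:
  "region_towards D p w R \<Longrightarrow> black_towards D black p w \<longleftrightarrow> R \<in> black"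
  unfolding black_towards_def by (metis region_towards_unique)

section \<open>Checkerboard colors beside a strand and around a crossing\<close>

context oriented_link
begin

text \<open>The push reaches the quadrant between \<open>\<sigma>\<close> times the velocity and
  \<open>w\<close> from nearby points of the strand. These are not double points, so there all
  directions on one side of the tangent lead to one region, and \<open>w\<close> may be replaced by
  the normal on its side.\<close>

lemma region_beside:
  assumes x: "x \<in> params D" and xw: "cross (velocity D x) w \<noteq> 0"
    and others: "\<And>y. y \<in> params D \<Longrightarrow> curve D y = curve D x \<Longrightarrow> y \<noteq> x \<Longrightarrow> cross (velocity D y) w = 0"
    and \<sigma>: "\<sigma> \<in> {1, -1 :: real}"
  shows "\<exists>R. region_towards D (curve D x) (of_real \<sigma> * velocity D x + w) R \<and>
           (\<forall>\<^sub>F t in at_right 0. travel x (\<sigma> * t) \<notin> double_params D \<and>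
              region_towards D (curve D (travel x (\<sigma> * t)))
                (of_real (sgn (cross (velocity D x) w)) * (\<i> * velocity D (travel x (\<sigma> * t)))) R)"
proof -
  obtain R where R: "region_towards D (curve D x) (of_real \<sigma> * velocity D x + w) R"
    "\<forall>\<^sub>F t in at_right 0. region_towards D (curve D (travel x (\<sigma> * t))) w R"
    using region_towards_push[OF assms] by blast
  define c where "c = sgn (cross (velocity D x) w)"
  have c: "c \<in> {1, -1}" "0 < c * cross (velocity D x) w"
    using xw by (auto simp: c_def sgn_if)
  note lim = filterlim_signed_at_right[OF \<sigma>]
  have simple: "\<forall>\<^sub>F t in at_right 0. travel x (\<sigma> * t) \<notin> double_params D"
    using eventually_compose_filterlim[OF eventually_travel_notin_finite[OF x finite_double_params] lim] .
  have "((\<lambda>t. c * cross (velocity D (travel x t)) w) \<longlongrightarrow> c * cross (velocity D (travel x 0)) w) (at 0)"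
    using continuous_velocity[OF x, of 0] by (intro tendsto_intros cross.tendsto) (simp add: isCont_def)
  then have "\<forall>\<^sub>F t in at 0. 0 < c * cross (velocity D (travel x t)) w"
    by (rule order_tendstoD(1)) (use c in auto)
  then have side: "\<forall>\<^sub>F t in at_right 0. 0 < c * cross (velocity D (travel x (\<sigma> * t))) w"
    using lim by (rule eventually_compose_filterlim)
  have "\<forall>\<^sub>F t in at_right 0. travel x (\<sigma> * t) \<notin> double_params D \<and>
      region_towards D (curve D (travel x (\<sigma> * t))) (of_real c * (\<i> * velocity D (travel x (\<sigma> * t)))) R"
    using R(2) simple side
  proof eventually_elim
    case (elim t)
    define y where "y = travel x (\<sigma> * t)"
    let ?v = "velocity D y"
    have y: "y \<in> params D" using x by (simp add: y_def)
    have only: "z = y" if "z \<in> params D" "curve D z = curve D y" for z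
      using elim(2) that y unfolding y_def[symmetric] double_params_def by blast
    have "region_towards D (curve D y) w R \<longleftrightarrow> region_towards D (curve D y) (of_real c * (\<i> * ?v)) R"
    proof (rule region_towards_sector)
      show "connected {d. 0 < cross (of_real c * ?v) d}"
        by (intro convex_connected convex_left_side)
      show "transverse D (curve D y) d" if "d \<in> {d. 0 < cross (of_real c * ?v) d}" for d
        using that by (auto simp: transverse_def dest!: only)
      show "w \<in> {d. 0 < cross (of_real c * ?v) d}" using elim(3) by (simp add: y_def)
      show "of_real c * (\<i> * ?v) \<in> {d. 0 < cross (of_real c * ?v) d}"
        using c(1) velocity_nonzero[OF y] by (auto simp: cross_ii cross.minus_left cross.minus_right)
    qed
    then show ?case using elim by (simp add: y_def)
  qed
  then show ?thesis using R(1) unfolding c_def by blast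
qed

lemma eventually_left_black:
  assumes x: "x \<in> params D" and xw: "cross (velocity D x) w > 0"
    and others: "\<And>y. y \<in> params D \<Longrightarrow> curve D y = curve D x \<Longrightarrow> y \<noteq> x \<Longrightarrow> cross (velocity D y) w = 0"
    and \<sigma>: "\<sigma> \<in> {1, -1 :: real}"
  shows "\<forall>\<^sub>F t in at_right 0. left_black D black (travel x (\<sigma> * t)) \<longleftrightarrow>
           black_towards D black (curve D x) (of_real \<sigma> * velocity D x + w)"
proof -
  have "cross (velocity D x) w \<noteq> 0" using xw by simp
  from region_beside[OF x this others \<sigma>] obtain R where R:
    "region_towards D (curve D x) (of_real \<sigma> * velocity D x + w) R"
    "\<forall>\<^sub>F t in at_right 0. travel x (\<sigma> * t) \<notin> double_params D \<and>
        region_towards D (curve D (travel x (\<sigma> * t))) (\<i> * velocity D (travel x (\<sigma> * t))) R"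
    using xw by auto
  from R(2) show ?thesis
    by eventually_elim (simp add: left_black_def black_towards_iff[OF R(1)] black_towards_iff)
qed

text \<open>The two quadrants border the same half-strand. The checkerboard condition speaks only of
  points that are not double points, so it is applied a little further along that
  half-strand.\<close>

lemma black_towards_other_side:
  assumes x: "x \<in> params D" and xw: "cross (velocity D x) w \<noteq> 0"
    and others: "\<And>y. y \<in> params D \<Longrightarrow> curve D y = curve D x \<Longrightarrow> y \<noteq> x \<Longrightarrow> cross (velocity D y) w = 0"
    and \<sigma>: "\<sigma> \<in> {1, -1 :: real}" and black: "checkerboard D black"
  shows "black_towards D black (curve D x) (of_real \<sigma> * velocity D x - w) \<longleftrightarrow>
          \<not> black_towards D black (curve D x) (of_real \<sigma> * velocity D x + w)"
proof -
  let ?c = "sgn (cross (velocity D x) w)"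
  let ?P = "\<lambda>t. travel x (\<sigma> * t)"
  obtain R where R:
    "region_towards D (curve D x) (of_real \<sigma> * velocity D x + w) R"
    "\<forall>\<^sub>F t in at_right 0. ?P t \<notin> double_params D \<and>
        region_towards D (curve D (?P t)) (of_real ?c * (\<i> * velocity D (?P t))) R"
    using region_beside[OF x xw others \<sigma>] by auto
  have "cross (velocity D x) (- w) \<noteq> 0" using xw by (simp add: cross.minus_right)
  from region_beside[OF x this _ \<sigma>] others obtain R' where R':
    "region_towards D (curve D x) (of_real \<sigma> * velocity D x - w) R'"
    "\<forall>\<^sub>F t in at_right 0. ?P t \<notin> double_params D \<and>
        region_towards D (curve D (?P t)) (- of_real ?c * (\<i> * velocity D (?P t))) R'"
    by (auto simp: cross.minus_right sgn_minus)
  \<comment> \<open>The statement does not depend on \<open>t\<close>; it can be read off because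
    the filter is nontrivial.\<close>
  have "\<forall>\<^sub>F t in at_right (0::real). R \<in> black \<longleftrightarrow> R' \<notin> black"
    using R(2) R'(2)
  proof eventually_elim
    case (elim t)
    have y: "?P t \<in> params D - double_params D" using elim x by simp
    have check: "L \<in> black \<longleftrightarrow> L' \<notin> black"
      if "region_towards D (curve D (?P t)) (\<i> * velocity D (?P t)) L"
        "region_towards D (curve D (?P t)) (- \<i> * velocity D (?P t)) L'" for L L'
      using black y that unfolding checkerboard_def by blast
    \<comment> \<open>The sign of \<open>cross\<close> decides which of \<open>R\<close> and
      \<open>R'\<close> lies on the left, hence the two orders of \<open>check\<close>.\<close>
    show ?case
      using check[of R R'] check[of R' R] elim xw by (cases "cross (velocity D x) w > 0") auto
  qed
  then have "R \<in> black \<longleftrightarrow> R' \<notin> black" by simp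
  then show ?thesis using black_towards_iff[OF R(1)] black_towards_iff[OF R'(1)] by simp
qed

text \<open>With a single strand through the point, the whole open left half-plane of directions is
  one sector, which contains both the normal and the direction reached by the push.\<close>

lemma left_black_locally_constant:
  assumes x: "x \<in> params D" "x \<notin> double_params D" and \<sigma>: "\<sigma> \<in> {1, -1 :: real}"
  shows "\<forall>\<^sub>F t in at_right 0. left_black D black (travel x (\<sigma> * t)) \<longleftrightarrow> left_black D black x"
proof -
  let ?v = "velocity D x"
  have only: "y = x" if "y \<in> params D" "curve D y = curve D x" for y
    using x that unfolding double_params_def by blast
  have pos: "0 < cross ?v (\<i> * ?v)"
    using velocity_nonzero[OF x(1)] by (simp add: cross_ii)
  have sector: "region_towards D (curve D x) (of_real \<sigma> * ?v + \<i> * ?v) R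
      \<longleftrightarrow> region_towards D (curve D x) (\<i> * ?v) R" for R
  proof (rule region_towards_sector)
    show "connected {d. 0 < cross ?v d}" by (intro convex_connected convex_left_side)
    show "transverse D (curve D x) d" if "d \<in> {d. 0 < cross ?v d}" for d
      using that by (auto simp: transverse_def dest!: only)
  qed (use pos in \<open>auto simp: cross.add_right\<close>)
  show ?thesis
    using eventually_left_black[OF x(1) pos _ \<sigma>, of black] only sector
    by (simp add: left_black_def black_towards_def)
qed

text \<open>Every swept direction lies in the quadrant between the over-velocity and
  \<open>u'\<close> or in the opposite one, and \<open>opp\<close> gives both the same color. The
  converse needs one swept direction that actually occurs.\<close>

lemma swept_black_iff:
  assumes p: "p \<in> params D" and u: "u \<in> params D" and ne: "p \<noteq> u" and eq: "curve D p = curve D u"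
    and only: "\<And>y. y \<in> params D \<Longrightarrow> curve D y = curve D p \<Longrightarrow> y = p \<or> y = u"
    and u': "u' = velocity D u \<or> u' = - velocity D u" and pos: "0 < cross (velocity D p) u'"
    and opp: "black_towards D black (curve D p) (- velocity D p - u') \<longleftrightarrow>
              black_towards D black (curve D p) (velocity D p + u')"
  shows "swept_regions D (p, u) \<subseteq> black \<longleftrightarrow> black_towards D black (curve D p) (velocity D p + u')"
proof -
  let ?v = "velocity D p"
  \<comment> \<open>\<open>S 1\<close> is the quadrant spanned by \<open>?v\<close> and
    \<open>u'\<close>, and \<open>S (- 1)\<close> is its negative.\<close>
  define S where "S c = {d. 0 < cross (c * ?v) d} \<inter> {d. 0 < cross d (c * u')}" for c :: complex
  have conn: "connected (S c)" for c
    unfolding S_def by (intro convex_connected convex_Int convex_left_side convex_right_side)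
  have trans: "transverse D (curve D p) d" if "d \<in> S 1 \<or> d \<in> S (- 1)" for d
    unfolding transverse_def
  proof (intro ballI impI)
    fix y assume "y \<in> params D" "curve D y = curve D p"
    then consider "y = p" | "y = u" using only by blast
    then show "cross (velocity D y) d \<noteq> 0"
      using that u' cross_commute[of d "velocity D u"]
      by cases (auto simp: S_def cross.minus_left cross.minus_right)
  qed
  have mem: "?v + u' \<in> S 1" "- ?v - u' \<in> S (- 1)"
    using pos cross_commute[of u' ?v]
    by (auto simp: S_def cross.add_left cross.add_right cross.diff_left cross.diff_right
        cross.minus_left cross.minus_right)
  have sec1: "region_towards D (curve D p) d R \<longleftrightarrow> region_towards D (curve D p) (?v + u') R"
    if "d \<in> S 1" for d R
    using conn[of 1] trans that mem(1) by (intro region_towards_sector[of "S 1"]) auto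
  have sec2: "region_towards D (curve D p) d R \<longleftrightarrow> region_towards D (curve D p) (- ?v - u') R"
    if "d \<in> S (- 1)" for d R
    using conn[of "- 1"] trans that mem(2) by (intro region_towards_sector[of "S (- 1)"]) auto
  show ?thesis
  proof
    assume sub: "swept_regions D (p, u) \<subseteq> black"
    obtain d where d: "d \<in> swept_directions ?v (velocity D u)" "0 < cross ?v d" "0 < cross d u'"
      using swept_direction_exists[OF pos u'] .
    have "d \<in> S 1" using d by (simp add: S_def)
    obtain R where R: "region_towards D (curve D p) d R"
      using region_towards_ex trans \<open>d \<in> S 1\<close> by blast
    then have "R \<in> swept_regions D (p, u)" using d(1) by (auto simp: swept_regions_def)
    then show "black_towards D black (curve D p) (?v + u')"
      using sub R sec1[OF \<open>d \<in> S 1\<close>] unfolding black_towards_def by blast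
  next
    assume bl: "black_towards D black (curve D p) (?v + u')"
    show "swept_regions D (p, u) \<subseteq> black"
    proof
      fix R assume "R \<in> swept_regions D (p, u)"
      then obtain d where d: "d \<in> swept_directions ?v (velocity D u)"
        "region_towards D (curve D p) d R"
        by (auto simp: swept_regions_def)
      obtain d' where d': "d = d' \<or> d = - d'" "0 < cross ?v d'" "0 < cross d' u'"
        using swept_direction_in_sector[OF pos u' d(1)] .
      then consider "d \<in> S 1" | "d \<in> S (- 1)"
        by (auto simp: S_def cross.minus_left cross.minus_right)
      then show "R \<in> black"
      proof cases
        case 1
        then show ?thesis using sec1 d(2) bl black_towards_iff by blast
      next
        case 2
        then show ?thesis using sec2 d(2) bl opp black_towards_iff by blast
      qed
    qed
  qed
qed

lemma under_subset: "under D \<subseteq> double_params D"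
  using diagram unfolding link_diagram_def by blast

lemma under_iff:
  "x \<in> params D \<Longrightarrow> y \<in> params D \<Longrightarrow> x \<noteq> y \<Longrightarrow> curve D x = curve D y \<Longrightarrow>
   x \<in> under D \<longleftrightarrow> y \<notin> under D"
  using diagram unfolding link_diagram_def by blast

lemma crossingD:
  assumes "(p, u) \<in> crossings D"
  shows "p \<in> params D" "u \<in> params D" "u \<in> under D" "p \<notin> under D" "p \<noteq> u" "curve D p = curve D u"
    "\<And>y. y \<in> params D \<Longrightarrow> curve D y = curve D p \<Longrightarrow> y = p \<or> y = u"
proof -
  show 1: "p \<in> params D" "u \<in> under D" "p \<noteq> u" "curve D p = curve D u"
    using assms by (auto simp: crossings_def)
  then show 2: "u \<in> params D" using under_subset by (auto simp: double_params_def)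
  show "p \<notin> under D" using under_iff[of p u] 1 2 by blast
  show "y = p \<or> y = u" if "y \<in> params D" "curve D y = curve D p" for y
    using diagram that 1 2 unfolding link_diagram_def by metis
qed

text \<open>Each of the four half-strands has one quadrant on its left. The swept quadrants are
  those to the left of the outgoing over-strand and of the incoming under-strand, whichever way the
  under-strand crosses.\<close>

lemma left_black_at_crossing:
  assumes pu: "(p, u) \<in> crossings D" and black: "checkerboard D black"
  shows "\<forall>\<^sub>F t in at_right 0. left_black D black (travel p t) \<longleftrightarrow> eps_pos D black (p, u) = 1"
    and "\<forall>\<^sub>F t in at_right 0. left_black D black (travel p (- t)) \<longleftrightarrow> eps_pos D black (p, u) \<noteq> 1"
    and "\<forall>\<^sub>F t in at_right 0. left_black D black (travel u t) \<longleftrightarrow> eps_pos D black (p, u) \<noteq> 1"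
    and "\<forall>\<^sub>F t in at_right 0. left_black D black (travel u (- t)) \<longleftrightarrow> eps_pos D black (p, u) = 1"
proof -
  note pu = crossingD[OF pu]
  define v where "v = velocity D p"
  define z where "z = velocity D u"
  \<comment> \<open>This sign puts \<open>s z\<close> on the left of the over-strand and
    \<open>- s v\<close> on the left of the under-strand; these are the push directions used
    below.\<close>
  define s where "s = (if 0 < cross v z then 1 else - 1 :: real)"
  define b where "b d = black_towards D black (curve D p) d" for d
  have vz: "cross v z \<noteq> 0" using crossing_transverse[of p u] pu by (simp add: v_def z_def)
  have zv: "cross z v = - cross v z" by (rule cross_commute)
  have s: "s \<in> {1, -1}" "s * s = 1" "0 < s * cross v z"
    using vz by (auto simp: s_def)
  have others_p: "cross (velocity D y) (of_real c * z) = 0"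
    if "y \<in> params D" "curve D y = curve D p" "y \<noteq> p" for y c
    using pu(7)[of y] that by (auto simp: z_def)
  have others_u: "cross (velocity D y) (of_real c * v) = 0"
    if "y \<in> params D" "curve D y = curve D u" "y \<noteq> u" for y c
    using pu(6) pu(7)[of y] that by (auto simp: v_def)
  have pos: "0 < cross (velocity D p) (of_real s * z)" "0 < cross (velocity D u) (of_real (- s) * v)"
    using s(3) zv unfolding cross_of_real_right v_def z_def by simp_all
  have ne: "cross (velocity D p) (of_real s * z) \<noteq> 0" "cross (velocity D u) (of_real (- s) * v) \<noteq> 0"
    by (rule pos[THEN less_imp_neq, THEN not_sym])+
  have over: "\<forall>\<^sub>F t in at_right 0. left_black D black (travel p (\<sigma> * t)) \<longleftrightarrow> b (of_real \<sigma> * v + of_real s * z)"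
    if "\<sigma> \<in> {1, -1}" for \<sigma>
    unfolding b_def v_def[symmetric]
    by (rule eventually_left_black[OF pu(1) pos(1) others_p that, folded v_def])
  have under: "\<forall>\<^sub>F t in at_right 0. left_black D black (travel u (\<sigma> * t)) \<longleftrightarrow> b (of_real \<sigma> * z + of_real (- s) * v)"
    if "\<sigma> \<in> {1, -1}" for \<sigma>
    unfolding b_def pu(6)
    by (rule eventually_left_black[OF pu(2) pos(2) others_u that, folded z_def])
  have flip_p: "b (of_real \<sigma> * v - of_real s * z) \<longleftrightarrow> \<not> b (of_real \<sigma> * v + of_real s * z)"
    if "\<sigma> \<in> {1, -1}" for \<sigma>
    unfolding b_def
    by (rule black_towards_other_side[OF pu(1) ne(1) others_p that black, folded v_def])
  have flip_u: "b (of_real \<sigma> * z - of_real (- s) * v) \<longleftrightarrow> \<not> b (of_real \<sigma> * z + of_real (- s) * v)"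
    if "\<sigma> \<in> {1, -1}" for \<sigma>
    unfolding b_def pu(6)
    by (rule black_towards_other_side[OF pu(2) ne(2) others_u that black, folded z_def])
  define B where "B = b (v + of_real s * z)"
  \<comment> \<open>Passing through any of the four half-strands flips the color, and two flips lead
    to the opposite quadrant.\<close>
  have vals: "b (of_real (- 1) * v + of_real s * z) \<longleftrightarrow> \<not> B"
    "b (- v - of_real s * z) \<longleftrightarrow> B"
    "b (of_real 1 * z + of_real (- s) * v) \<longleftrightarrow> \<not> B"
    "b (of_real (- 1) * z + of_real (- s) * v) \<longleftrightarrow> B"
    using flip_p[of 1] flip_p[of "- 1"] flip_u[of 1] flip_u[of "- 1"] s(1)
    by (auto simp: B_def algebra_simps)
  have "swept_regions D (p, u) \<subseteq> black \<longleftrightarrow>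
      black_towards D black (curve D p) (velocity D p + of_real s * z)"
  proof (rule swept_black_iff[OF pu(1,2,5,6,7) _ pos(1)])
    show "of_real s * z = velocity D u \<or> of_real s * z = - velocity D u"
      using s(1) by (auto simp: z_def)
    show "black_towards D black (curve D p) (- velocity D p - of_real s * z) \<longleftrightarrow>
        black_towards D black (curve D p) (velocity D p + of_real s * z)"
      using vals(2) unfolding B_def b_def v_def .
  qed
  then have eps: "eps_pos D black (p, u) = 1 \<longleftrightarrow> B" by (simp add: eps_pos_def B_def b_def v_def)
  show "\<forall>\<^sub>F t in at_right 0. left_black D black (travel p t) \<longleftrightarrow> eps_pos D black (p, u) = 1"
    using over[of 1] by (simp add: eps B_def)
  show "\<forall>\<^sub>F t in at_right 0. left_black D black (travel p (- t)) \<longleftrightarrow> eps_pos D black (p, u) \<noteq> 1"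
    using over[of "- 1"] unfolding vals eps by simp
  show "\<forall>\<^sub>F t in at_right 0. left_black D black (travel u t) \<longleftrightarrow> eps_pos D black (p, u) \<noteq> 1"
    using under[of 1] unfolding vals eps by simp
  show "\<forall>\<^sub>F t in at_right 0. left_black D black (travel u (- t)) \<longleftrightarrow> eps_pos D black (p, u) = 1"
    using under[of "- 1"] unfolding vals eps by simp
qed

end

section \<open>Arcs\<close>

lemma eventually_at_left_0_iff: "eventually P (at_left 0) \<longleftrightarrow> (\<forall>\<^sub>F t in at_right (0::real). P (- t))"
  using eventually_at_left_to_right[of P 0] by simp

lemma arcs_eqI: "A \<in> arcs D \<Longrightarrow> A' \<in> arcs D \<Longrightarrow> z \<in> A \<Longrightarrow> z \<in> A' \<Longrightarrow> A = A'"
  unfolding arcs_def using components_eq[of A _ A'] by blast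

lemma arcs_eventually_eqI:
  assumes "A \<in> arcs D" "A' \<in> arcs D"
    and "\<forall>\<^sub>F t in at_right (0::real). g t \<in> A" "\<forall>\<^sub>F t in at_right 0. g t \<in> A'"
  shows "A = A'"
proof -
  have "\<forall>\<^sub>F t in at_right 0. g t \<in> A \<inter> A'" using assms(3,4) by (auto elim: eventually_elim2)
  then obtain t where "g t \<in> A \<inter> A'" using eventually_happens[of _ "at_right (0::real)"] by fastforce
  then show ?thesis using arcs_eqI assms(1,2) by blast
qed

lemma outgoing_arc_eqI:
  assumes "A \<in> arcs D" "\<forall>\<^sub>F t in at_right 0. travel x t \<in> A"
  shows "outgoing_arc D x = A"
  unfolding outgoing_arc_def
proof (rule the_equality)
  fix A' assume "A' \<in> arcs D \<and> (\<forall>\<^sub>F t in at_right 0. travel x t \<in> A')"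
  then show "A' = A" using arcs_eventually_eqI[of A' D A "travel x"] assms by blast
qed (use assms in blast)

lemma incoming_arc_eqI:
  assumes "A \<in> arcs D" "\<forall>\<^sub>F t in at_right 0. travel x (- t) \<in> A"
  shows "incoming_arc D x = A"
  unfolding incoming_arc_def eventually_at_left_0_iff
proof (rule the_equality)
  fix A' assume "A' \<in> arcs D \<and> (\<forall>\<^sub>F t in at_right 0. travel x (- t) \<in> A')"
  then show "A' = A" using arcs_eventually_eqI[of A' D A "\<lambda>t. travel x (- t)"] assms by blast
qed (use assms in blast)

lemma over_arc_eqI: "A \<in> arcs D \<Longrightarrow> fst x \<in> A \<Longrightarrow> over_arc D x = A"
  unfolding over_arc_def by (rule the_equality) (blast, metis arcs_eqI)

context oriented_link
begin

text \<open>There are finitely many undercrossings, so a short stretch of the path starting at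
  \<open>x\<close> avoids them and, being connected, lies in one arc.\<close>

lemma arc_beside:
  assumes x: "x \<in> params D" and \<sigma>: "\<sigma> \<in> {1, -1 :: real}"
  obtains A where "A \<in> arcs D" "\<forall>\<^sub>F t in at_right 0. travel x (\<sigma> * t) \<in> A" "x \<notin> under D \<Longrightarrow> x \<in> A"
proof -
  have fin: "finite (under D)" using under_subset finite_double_params by (rule finite_subset)
  obtain d where d: "d > 0" "\<And>t. t \<noteq> 0 \<Longrightarrow> \<bar>t\<bar> < d \<Longrightarrow> travel x t \<notin> under D"
    using eventually_travel_notin_finite[OF x fin] by (auto simp: eventually_at dist_real_def)
  \<comment> \<open>An undercrossing belongs to no arc and must be left out; otherwise
    \<open>t = 0\<close> is kept, which places \<open>x\<close> itself in the arc.\<close>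
  define I where "I = (if x \<in> under D then {0<..<d} else {0..<d})"
  define N where "N = (\<lambda>t. travel x (\<sigma> * t)) ` I"
  have "connected I" by (simp add: I_def)
  moreover have "continuous_on I (\<lambda>t. travel x (\<sigma> * t))"
    by (rule continuous_on_compose2[OF continuous_on_travel[of UNIV]]) (auto intro!: continuous_intros)
  ultimately have "connected N" unfolding N_def by (intro connected_continuous_image)
  moreover have "N \<subseteq> params D - under D"
  proof
    fix z assume "z \<in> N"
    then obtain t where t: "t \<in> I" "z = travel x (\<sigma> * t)" unfolding N_def by (rule imageE)
    show "z \<in> params D - under D"
    proof (cases "t = 0")
      case True
      then show ?thesis using t x by (auto simp: I_def split: if_splits)
    next
      case False
      have "\<bar>\<sigma> * t\<bar> < d" using t(1) \<sigma> by (auto simp: I_def split: if_splits)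
      then have "travel x (\<sigma> * t) \<notin> under D" using d(2)[of "\<sigma> * t"] False \<sigma> by auto
      then show ?thesis using t x by simp
    qed
  qed
  moreover have "N \<noteq> {}"
  proof -
    have "d / 2 \<in> I" using d(1) by (simp add: I_def)
    then show ?thesis unfolding N_def by blast
  qed
  ultimately obtain A where A: "A \<in> arcs D" "N \<subseteq> A"
    unfolding arcs_def using exists_component_superset[of N "params D - under D"] by auto
  have "travel x (\<sigma> * t) \<in> A" if "t \<in> {0<..<d}" for t
  proof -
    have "t \<in> I" using that by (simp add: I_def)
    then show ?thesis using A(2) unfolding N_def by blast
  qed
  then have "\<forall>\<^sub>F t in at_right 0. travel x (\<sigma> * t) \<in> A"
    by (rule eventually_mono[OF eventually_at_right_real[OF d(1)]])
  moreover have "x \<in> A" if "x \<notin> under D"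
  proof -
    have "travel x (\<sigma> * 0) \<in> N" unfolding N_def using that d(1) by (intro imageI) (simp add: I_def)
    then show ?thesis using A(2) by auto
  qed
  ultimately show thesis using A(1) that by blast
qed

text \<open>\<open>over_arc\<close> looks only at the first component, so \<open>y\<close> is a
  dummy: away from undercrossings, \<open>over_arc D (x, y)\<close> is simply the arc through
  \<open>x\<close>.\<close>

lemma outgoing_arc:
  assumes "x \<in> params D"
  shows "outgoing_arc D x \<in> arcs D" "\<forall>\<^sub>F t in at_right 0. travel x t \<in> outgoing_arc D x"
    "x \<notin> under D \<Longrightarrow> outgoing_arc D x = over_arc D (x, y)"
proof -
  obtain A where A: "A \<in> arcs D" "\<forall>\<^sub>F t in at_right 0. travel x t \<in> A" "x \<notin> under D \<Longrightarrow> x \<in> A"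
    using arc_beside[OF assms, of 1] by auto
  then have eq: "outgoing_arc D x = A" by (intro outgoing_arc_eqI)
  show "outgoing_arc D x \<in> arcs D" "\<forall>\<^sub>F t in at_right 0. travel x t \<in> outgoing_arc D x"
    using A eq by simp_all
  show "outgoing_arc D x = over_arc D (x, y)" if "x \<notin> under D"
    using over_arc_eqI[of A D "(x, y)"] A eq that by simp
qed

lemma incoming_arc:
  assumes "x \<in> params D"
  shows "incoming_arc D x \<in> arcs D" "\<forall>\<^sub>F t in at_right 0. travel x (- t) \<in> incoming_arc D x"
    "x \<notin> under D \<Longrightarrow> incoming_arc D x = over_arc D (x, y)"
proof -
  obtain A where A: "A \<in> arcs D" "\<forall>\<^sub>F t in at_right 0. travel x (- t) \<in> A" "x \<notin> under D \<Longrightarrow> x \<in> A"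
    using arc_beside[OF assms, of "- 1"] by auto
  then have eq: "incoming_arc D x = A" by (intro incoming_arc_eqI)
  show "incoming_arc D x \<in> arcs D" "\<forall>\<^sub>F t in at_right 0. travel x (- t) \<in> incoming_arc D x"
    using A eq by simp_all
  show "incoming_arc D x = over_arc D (x, y)" if "x \<notin> under D"
    using over_arc_eqI[of A D "(x, y)"] A eq that by simp
qed

lemma crossing_arcs:
  assumes "x \<in> crossings D"
  shows "right_under_arc D x \<in> arcs D" "left_under_arc D x \<in> arcs D" "over_arc D x \<in> arcs D"
proof -
  obtain p u where x: "x = (p, u)" by (cases x)
  note pu = crossingD[OF assms[unfolded x]]
  show "right_under_arc D x \<in> arcs D" "left_under_arc D x \<in> arcs D"
    using outgoing_arc(1)[OF pu(2)] incoming_arc(1)[OF pu(2)]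
    by (simp_all add: x right_under_arc_def left_under_arc_def)
  show "over_arc D x \<in> arcs D"
    using outgoing_arc(1)[OF pu(1)] outgoing_arc(3)[OF pu(1,4), of u] x by simp
qed

lemma finite_crossings: "finite (crossings D)"
proof (rule finite_subset)
  show "crossings D \<subseteq> double_params D \<times> double_params D"
  proof
    fix x assume "x \<in> crossings D"
    then obtain p u where x: "x = (p, u)" "(p, u) \<in> crossings D" by (cases x) simp
    note pu = crossingD[OF x(2)]
    show "x \<in> double_params D \<times> double_params D"
      using pu(1,2,5,6) x(1) unfolding double_params_def by auto
  qed
  show "finite (double_params D \<times> double_params D)" using finite_double_params by simp
qed

text \<open>Without triple points, every double parameter is the upper or the lower end of exactly
  one crossing, and never both.\<close>

lemma sum_double_params:
  "(\<Sum>x\<in>double_params D. J x) = (\<Sum>(p, u)\<in>crossings D. J p + J u)"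
proof -
  let ?C = "crossings D"
  have eq: "double_params D = fst ` ?C \<union> snd ` ?C"
  proof (intro equalityI subsetI)
    fix x assume "x \<in> double_params D"
    then obtain y where xy: "x \<in> params D" "y \<in> params D" "y \<noteq> x" "curve D y = curve D x"
      unfolding double_params_def by blast
    have "(x, y) \<in> ?C \<or> (y, x) \<in> ?C"
      using under_iff[of x y] xy unfolding crossings_def by auto
    then show "x \<in> fst ` ?C \<union> snd ` ?C" by force
  next
    fix x assume "x \<in> fst ` ?C \<union> snd ` ?C"
    then obtain p u where pu: "(p, u) \<in> ?C" "x = p \<or> x = u" by auto
    show "x \<in> double_params D"
      using crossingD(1,2,5,6)[OF pu(1)] pu(2) unfolding double_params_def by auto
  qed
  have disj: "fst ` ?C \<inter> snd ` ?C = {}"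
  proof -
    have "p \<noteq> u'" if "(p, u) \<in> ?C" "(p', u') \<in> ?C" for p u p' u'
      using crossingD(4)[OF that(1)] crossingD(3)[OF that(2)] by blast
    then show ?thesis by force
  qed
  have inj1: "inj_on fst ?C"
  proof (rule inj_onI)
    fix x y assume xy: "x \<in> ?C" "y \<in> ?C" "fst x = fst y"
    obtain p u u' where eqs: "x = (p, u)" "y = (p, u')" using xy(3) by (metis prod.collapse)
    note c = xy(1,2)[unfolded eqs]
    have "u' = p \<or> u' = u"
      by (rule crossingD(7)[OF c(1)]) (use crossingD(2,6)[OF c(2)] in auto)
    then show "x = y" using crossingD(5)[OF c(2)] eqs by auto
  qed
  have inj2: "inj_on snd ?C"
  proof (rule inj_onI)
    fix x y assume xy: "x \<in> ?C" "y \<in> ?C" "snd x = snd y"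
    obtain p u p' where eqs: "x = (p, u)" "y = (p', u)" using xy(3) by (metis prod.collapse)
    note c = xy(1,2)[unfolded eqs]
    have "p' = p \<or> p' = u"
      by (rule crossingD(7)[OF c(1)]) (use crossingD(1,6)[OF c(2)] crossingD(6)[OF c(1)] in auto)
    then show "x = y" using crossingD(5)[OF c(2)] eqs by auto
  qed
  have "(\<Sum>x\<in>double_params D. J x) = (\<Sum>x\<in>fst ` ?C. J x) + (\<Sum>x\<in>snd ` ?C. J x)"
    unfolding eq using finite_crossings disj by (intro sum.union_disjoint) auto
  also have "\<dots> = (\<Sum>x\<in>?C. J (fst x)) + (\<Sum>x\<in>?C. J (snd x))"
    using inj1 inj2 by (simp add: sum.reindex)
  also have "\<dots> = (\<Sum>(p, u)\<in>?C. J p + J u)"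
    by (simp add: sum.distrib case_prod_unfold)
  finally show ?thesis .
qed

end

section \<open>Jumps along the circles of a link\<close>

lemma inj_on_travel_circle: "inj_on (travel (i, 1)) {0..<2 * pi}"
proof (rule inj_on_inverseI)
  fix t :: real assume t: "t \<in> {0..<2 * pi}"
  show "Arg2pi (snd (travel (i, 1) t)) = t"
    by (rule Arg2pi_unique[of 1]) (use t in \<open>auto simp: travel_def cis_conv_exp\<close>)
qed

text \<open>On each circle the times 0 and \<open>2 * pi\<close> are the same parameter, so the two
  end terms of the interval formula cancel; the circles are then added up.\<close>

lemma total_jump_params:
  fixes h hp hm :: "param \<Rightarrow> 'a::ab_group_add"
  assumes right: "\<And>x. x \<in> params D \<Longrightarrow> \<forall>\<^sub>F t in at_right 0. h (travel x t) = hp x"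
    and left: "\<And>x. x \<in> params D \<Longrightarrow> \<forall>\<^sub>F t in at_right 0. h (travel x (- t)) = hm x"
    and X: "finite X" "X \<subseteq> params D"
    and cont: "\<And>x. x \<in> params D \<Longrightarrow> x \<notin> X \<Longrightarrow> hp x = hm x"
  shows "(\<Sum>x\<in>X. hp x - hm x) = 0"
proof -
  have "(\<Sum>x\<in>{x \<in> X. fst x = i}. hp x - hm x) = 0" if i: "i < components_no D" for i
  proof -
    let ?z = "travel (i, 1)"
    define S where "S = {t \<in> {0..<2 * pi}. ?z t \<in> X}"
    have z: "?z t \<in> params D" for t using i by (subst travel_in_params) (simp add: params_def)
    have inj: "inj_on ?z S" by (rule inj_on_subset[OF inj_on_travel_circle]) (auto simp: S_def)
    have img: "?z ` S = {x \<in> X. fst x = i}"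
    proof (intro equalityI subsetI)
      fix x assume x: "x \<in> {x \<in> X. fst x = i}"
      then have "x \<in> params D" using X by blast
      then obtain t where "t \<in> {0..<2 * pi}" "x = travel (fst x, 1) t" by (rule params_eq_travel)
      then show "x \<in> ?z ` S" using x by (auto simp: S_def)
    qed (auto simp: S_def travel_def)
    have fin: "finite S"
      by (rule finite_imageD[OF _ inj]) (use X(1) in \<open>simp add: img\<close>)
    have "(\<Sum>t\<in>S. hp (?z t) - hm (?z t)) = hm (?z (2 * pi)) - hm (?z 0)"
    proof (rule total_jump_interval[where H = "\<lambda>t. h (?z t)"])
      show "\<forall>\<^sub>F s in at_right t. h (?z s) = hp (?z t)" for t
        using right[OF z[of t]] unfolding eventually_at_right_to_0[of _ t] by (simp add: add.commute)
      show "\<forall>\<^sub>F s in at_left t. h (?z s) = hm (?z t)" for t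
        using left[OF z[of t]] unfolding eventually_at_left_to_right[of _ t] eventually_at_right_to_0[of _ "- t"]
        by simp
      show "hp (?z t) = hm (?z t)" if "t \<in> {0..<2 * pi} - S" for t
        using that by (intro cont z) (auto simp: S_def)
    qed (use fin in \<open>auto simp: S_def\<close>)
    also have "?z (2 * pi) = ?z 0" by (simp add: travel_def)
    finally have "(\<Sum>t\<in>S. hp (?z t) - hm (?z t)) = 0" by simp
    then show ?thesis by (simp add: img[symmetric] sum.reindex[OF inj])
  qed
  moreover have "(\<Sum>i<components_no D. \<Sum>x\<in>{x \<in> X. fst x = i}. hp x - hm x) = (\<Sum>x\<in>X. hp x - hm x)"
    using X by (intro sum.group) (auto simp: params_def)
  ultimately show ?thesis by simp
qed

section \<open>Translating a coloring\<close>

text \<open>The values lie in a mere abelian group, so a sign is a Boolean instead of a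
  factor.\<close>

definition signed :: "bool \<Rightarrow> 'a::ab_group_add \<Rightarrow> 'a" where
  "signed b v = (if b then v else - v)"

context oriented_link
begin

lemma pos_weight_eq:
  "pos_weight D black col w =
     (\<Sum>x\<in>crossings D. signed (eps_pos D black x = 1) (w (col (right_under_arc D x)) (col (over_arc D x))))"
  by (simp add: pos_weight_def signed_def Let_def)

lemma pos_weight_cong:
  assumes "\<And>A. A \<in> arcs D \<Longrightarrow> col A = col' A"
  shows "pos_weight D black col w = pos_weight D black col' w"
  unfolding pos_weight_eq
proof (rule sum.cong)
  fix x assume "x \<in> crossings D"
  note crossing_arcs[OF this, THEN assms]
  then show "signed (eps_pos D black x = 1) (w (col (right_under_arc D x)) (col (over_arc D x)))
      = signed (eps_pos D black x = 1) (w (col' (right_under_arc D x)) (col' (over_arc D x)))"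
    by simp
qed simp

lemma sum_signed_arcs:
  fixes F :: "param set \<Rightarrow> 'a::ab_group_add"
  assumes black: "checkerboard D black"
  shows "(\<Sum>x\<in>crossings D. signed (eps_pos D black x = 1)
           (F (over_arc D x) + F (over_arc D x) - F (right_under_arc D x) - F (left_under_arc D x))) = 0"
proof -
  \<comment> \<open>The pair \<open>(x, x)\<close> serves only to name the arc through
    \<open>x\<close>. At undercrossings the value is unspecified, which is harmless because jumps
    depend only on nearby values.\<close>
  define h where "h x = signed (left_black D black x) (F (over_arc D (x, x)))" for x
  define hp where "hp x = signed (\<forall>\<^sub>F t in at_right 0. left_black D black (travel x t))
      (F (outgoing_arc D x))" for x
  define hm where "hm x = signed (\<forall>\<^sub>F t in at_right 0. left_black D black (travel x (- t)))
      (F (incoming_arc D x))" for x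
  have crossing: "\<exists>y. (x, y) \<in> crossings D \<or> (y, x) \<in> crossings D" if "x \<in> double_params D" for x
    using that under_iff unfolding double_params_def crossings_def by fastforce
  \<comment> \<open>The color on the left settles on either side of each parameter. Hence the
    failure of an eventual statement in \<open>hp\<close> or \<open>hm\<close> means that the color
    is eventually white, and the sign chosen there is the right one.\<close>
  have const: "\<exists>b. \<forall>\<^sub>F t in at_right 0. left_black D black (travel x (\<sigma> * t)) = b"
    if x: "x \<in> params D" and \<sigma>: "\<sigma> \<in> {1, -1}" for x \<sigma>
  proof (cases "x \<in> double_params D")
    case False
    then show ?thesis using left_black_locally_constant[OF x _ \<sigma>] by blast
  next
    case True
    then obtain y where "(x, y) \<in> crossings D \<or> (y, x) \<in> crossings D" using crossing by blast
    then show ?thesis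
    proof
      assume "(x, y) \<in> crossings D"
      from left_black_at_crossing(1,2)[OF this black] \<sigma> show ?thesis by auto
    next
      assume "(y, x) \<in> crossings D"
      from left_black_at_crossing(3,4)[OF this black] \<sigma> show ?thesis by auto
    qed
  qed
  have arc: "over_arc D (z, z) = A" if "A \<in> arcs D" "z \<in> A" for z A
    using over_arc_eqI[of A D "(z, z)"] that by simp
  have "(\<Sum>x\<in>double_params D. hp x - hm x) = 0"
  proof (rule total_jump_params)
    fix x assume x: "x \<in> params D"
    obtain b where b: "\<forall>\<^sub>F t in at_right 0. left_black D black (travel x t) = b"
      using const[OF x, of 1] by auto
    have "(\<forall>\<^sub>F t in at_right 0. left_black D black (travel x t)) = b"
      using eventually_subst[OF b] by simp
    then have hp: "hp x = signed b (F (outgoing_arc D x))" by (simp add: hp_def)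
    show "\<forall>\<^sub>F t in at_right 0. h (travel x t) = hp x"
      using b outgoing_arc(2)[OF x]
      by eventually_elim (simp add: hp h_def arc[OF outgoing_arc(1)[OF x]])
    obtain b' where b': "\<forall>\<^sub>F t in at_right 0. left_black D black (travel x (- t)) = b'"
      using const[OF x, of "- 1"] by auto
    have "(\<forall>\<^sub>F t in at_right 0. left_black D black (travel x (- t))) = b'"
      using eventually_subst[OF b'] by simp
    then have hm: "hm x = signed b' (F (incoming_arc D x))" by (simp add: hm_def)
    show "\<forall>\<^sub>F t in at_right 0. h (travel x (- t)) = hm x"
      using b' incoming_arc(2)[OF x]
      by eventually_elim (simp add: hm h_def arc[OF incoming_arc(1)[OF x]])
    assume nd: "x \<notin> double_params D"
    have "b = left_black D black x"
    proof -
      have "\<forall>\<^sub>F t in at_right (0::real). b = left_black D black x"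
        using b left_black_locally_constant[OF x nd, of 1 black, simplified] by eventually_elim simp
      then show ?thesis by simp
    qed
    moreover have "b' = left_black D black x"
    proof -
      have "\<forall>\<^sub>F t in at_right (0::real). b' = left_black D black x"
        using b' left_black_locally_constant[OF x nd, of "- 1" black, simplified] by eventually_elim simp
      then show ?thesis by simp
    qed
    moreover have "outgoing_arc D x = incoming_arc D x"
      using outgoing_arc(3)[OF x, of x] incoming_arc(3)[OF x, of x] nd under_subset by auto
    ultimately show "hp x = hm x" by (simp add: hp hm)
  qed (use finite_double_params in \<open>auto simp: double_params_def\<close>)
  then have "(\<Sum>(p, u)\<in>crossings D. (hp p - hm p) + (hp u - hm u)) = 0"
    by (simp add: sum_double_params)
  moreover have "(hp p - hm p) + (hp u - hm u) = signed (eps_pos D black (p, u) = 1)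
      (F (over_arc D (p, u)) + F (over_arc D (p, u)) - F (right_under_arc D (p, u)) - F (left_under_arc D (p, u)))"
    if c: "(p, u) \<in> crossings D" for p u
  proof -
    let ?e = "eps_pos D black (p, u) = 1"
    note pu = crossingD[OF c]
    note lb = left_black_at_crossing[OF c black]
    have "(\<forall>\<^sub>F t in at_right 0. left_black D black (travel p t)) = ?e"
      "(\<forall>\<^sub>F t in at_right 0. left_black D black (travel p (- t))) = (\<not> ?e)"
      "(\<forall>\<^sub>F t in at_right 0. left_black D black (travel u t)) = (\<not> ?e)"
      "(\<forall>\<^sub>F t in at_right 0. left_black D black (travel u (- t))) = ?e"
      using eventually_subst[OF lb(1)] eventually_subst[OF lb(2)]
        eventually_subst[OF lb(3)] eventually_subst[OF lb(4)] by simp_all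
    then have "hp p = signed ?e (F (over_arc D (p, u)))" "hm p = signed (\<not> ?e) (F (over_arc D (p, u)))"
      "hp u = signed (\<not> ?e) (F (outgoing_arc D u))" "hm u = signed ?e (F (incoming_arc D u))"
      using outgoing_arc(3)[OF pu(1,4), of u] incoming_arc(3)[OF pu(1,4), of u]
      by (simp_all add: hp_def hm_def)
    then show ?thesis
      by (simp add: signed_def right_under_arc_def left_under_arc_def algebra_simps)
  qed
  ultimately show ?thesis by (simp add: case_prod_unfold cong: sum.cong)
qed

end

context quandle
begin

text \<open>Translations and their inverses are quandle endomorphisms, so they preserve the relation
  at each crossing.\<close>

lemma coloring_rhd_sgn:
  assumes D: "link_diagram D" and col: "coloring D col" and c: "c \<in> Q"
  shows "coloring D (\<lambda>A. rhd_sgn e (col A) c)"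
proof -
  interpret oriented_link D by standard (rule D)
  show ?thesis
    unfolding coloring_def
  proof (intro conjI ballI)
    show "rhd_sgn e (col A) c \<in> Q" if "A \<in> arcs D" for A
      using col c that by (simp add: coloring_def rhd_sgn_closed)
    show "rhd_sgn e (col (left_under_arc D x)) c
        = rhd_sgn e (col (right_under_arc D x)) c \<lhd> rhd_sgn e (col (over_arc D x)) c"
      if "x \<in> crossings D" for x
      using col c that crossing_arcs[OF that] by (simp add: coloring_def rhd_sgn_distrib)
  qed
qed

lemma pos_weight_rhd:
  assumes D: "link_diagram D" and col: "coloring D col" and c: "c \<in> Q"
    and w: "positive_cocycle w" and black: "checkerboard D black"
  shows "pos_weight D black (\<lambda>A. col A \<lhd> c) w = - pos_weight D black col w"
proof -
  interpret oriented_link D by standard (rule D)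
  let ?s = "\<lambda>x. signed (eps_pos D black x = 1)"
  let ?a = "\<lambda>x. col (right_under_arc D x)" and ?b = "\<lambda>x. col (over_arc D x)"
  have eq: "?s x (w (?b x) c + w (?b x) c - w (?a x) c - w (col (left_under_arc D x)) c)
      = - (?s x (w (?a x \<lhd> c) (?b x \<lhd> c)) + ?s x (w (?a x) (?b x)))" if x: "x \<in> crossings D" for x
  proof -
    have Q: "?a x \<in> Q" "?b x \<in> Q" using col crossing_arcs[OF x] by (auto simp: coloring_def)
    have "w (?a x) c + w (?a x \<lhd> ?b x) c
        = w (?a x \<lhd> c) (?b x \<lhd> c) + w (?a x) (?b x) + (w (?b x) c + w (?b x) c)"
      using w Q c unfolding positive_cocycle_def by blast
    moreover have "col (left_under_arc D x) = ?a x \<lhd> ?b x" using col x by (simp add: coloring_def)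
    ultimately have "w (?a x) c + w (col (left_under_arc D x)) c
        = w (?a x \<lhd> c) (?b x \<lhd> c) + w (?a x) (?b x) + (w (?b x) c + w (?b x) c)" by simp
    then have "w (?b x) c + w (?b x) c - w (?a x) c - w (col (left_under_arc D x)) c
        = - (w (?a x \<lhd> c) (?b x \<lhd> c) + w (?a x) (?b x))"
      by (simp add: diff_diff_eq)
    then show ?thesis by (simp add: signed_def)
  qed
  have "0 = (\<Sum>x\<in>crossings D. - (?s x (w (?a x \<lhd> c) (?b x \<lhd> c)) + ?s x (w (?a x) (?b x))))"
    using sum_signed_arcs[OF black, of "\<lambda>A. w (col A) c"] eq by (simp cong: sum.cong)
  also have "\<dots> = - (pos_weight D black (\<lambda>A. col A \<lhd> c) w + pos_weight D black col w)"
    by (simp add: pos_weight_eq sum_negf sum.distrib sum_subtractf)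
  finally have "pos_weight D black (\<lambda>A. col A \<lhd> c) w + pos_weight D black col w = 0"
    by (metis neg_equal_0_iff_equal)
  then show ?thesis by (simp only: eq_neg_iff_add_eq_0)
qed

lemma pos_weight_rhd_sgn:
  assumes D: "link_diagram D" and col: "coloring D col" and c: "c \<in> Q"
    and w: "positive_cocycle w" and black: "checkerboard D black"
  shows "pos_weight D black (\<lambda>A. rhd_sgn e (col A) c) w = - pos_weight D black col w"
proof (cases "e = 1")
  case True
  then show ?thesis using pos_weight_rhd[OF assms] by (simp add: rhd_sgn_def)
next
  case False
  interpret oriented_link D by standard (rule D)
  let ?col' = "\<lambda>A. rhd_sgn e (col A) c"
  \<comment> \<open>The inverse translation is reduced to the direct one: translating the new
    coloring by \<open>c\<close> gives back the old one.\<close>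
  have "pos_weight D black (\<lambda>A. ?col' A \<lhd> c) w = - pos_weight D black ?col' w"
    by (intro pos_weight_rhd coloring_rhd_sgn assms)
  also have "pos_weight D black (\<lambda>A. ?col' A \<lhd> c) w = pos_weight D black col w"
    using False col c by (intro pos_weight_cong) (simp add: rhd_sgn_def coloring_def rhd_inv_rhd)
  finally show ?thesis by simp
qed

text \<open>The first conjunct is carried along because the next sign change applies to colorings
  only.\<close>

lemma pos_weight_iterated_rhd:
  assumes D: "link_diagram D" and col: "coloring D col"
    and w: "positive_cocycle w" and black: "checkerboard D black"
    and c: "\<And>i. i \<in> {1..m} \<Longrightarrow> c i \<in> Q"
  shows "coloring D (\<lambda>A. iterated_rhd e c (col A) m) \<and>
    pos_weight D black (\<lambda>A. iterated_rhd e c (col A) m) w = signed (even m) (pos_weight D black col w)"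
  using c
proof (induction m)
  case 0
  then show ?case using col by (simp add: signed_def)
next
  case (Suc m)
  have c: "c (Suc m) \<in> Q" using Suc.prems by simp
  have IH: "coloring D (\<lambda>A. iterated_rhd e c (col A) m)"
    "pos_weight D black (\<lambda>A. iterated_rhd e c (col A) m) w = signed (even m) (pos_weight D black col w)"
    using Suc.IH Suc.prems by simp_all
  show ?case
    using coloring_rhd_sgn[OF D IH(1) c] pos_weight_rhd_sgn[OF D IH(1) c w black] IH(2)
    by (simp add: signed_def)
qed

end

theorem proposition5p3:
  fixes Q :: "'q set"
    and rhd rhd_inv :: "'q \<Rightarrow> 'q \<Rightarrow> 'q"
    and k :: nat and c :: "nat \<Rightarrow> 'q" and e :: "nat \<Rightarrow> int"
    and w :: "'q \<Rightarrow> 'q \<Rightarrow> 'a::ab_group_add"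
    and D :: diagram and col :: "param set \<Rightarrow> 'q" and black :: "complex set set"
  assumes "quandle Q rhd rhd_inv"
    and "odd k"
    and "\<And>i. i \<in> {1..k} \<Longrightarrow> c i \<in> Q"
    and "\<And>i. i \<in> {1..k} \<Longrightarrow> e i \<in> {1, -1}"
    and "\<And>a. a \<in> Q \<Longrightarrow> quandle.iterated_rhd rhd rhd_inv e c a k = a"
    and "quandle.positive_cocycle Q rhd w"
    and "link_diagram D"
    and "quandle.coloring Q rhd D col"
    and "checkerboard D black"
    and "pos_weight D black col w \<noteq> 0"
  shows "has_order (pos_weight D black col w) 2"
proof -
  interpret quandle Q rhd rhd_inv by fact
  interpret oriented_link D by standard fact
  let ?W = "pos_weight D black col w"
  \<comment> \<open>The assumed relation holds on \<open>Q\<close>, and arcs have their colors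
    there, so the iterated translation restores the color of every arc.\<close>
  have "?W = pos_weight D black (\<lambda>A. iterated_rhd e c (col A) k) w"
    using assms(5,8) by (intro pos_weight_cong) (simp add: coloring_def)
  also have "\<dots> = - ?W"
    using pos_weight_iterated_rhd[OF assms(7,8,6,9,3), where m = k and e = e] assms(2) by (simp add: signed_def)
  finally have "?W + ?W = 0" by (simp only: eq_neg_iff_add_eq_0)
  moreover have "(\<Sum>i<m. ?W) \<noteq> 0" if "0 < m" "m < 2" for m :: nat
  proof -
    have "m = 1" using that by simp
    then show ?thesis using assms(10) by simp
  qed
  ultimately show ?thesis
    unfolding has_order_def by (simp add: numeral_2_eq_2)
qed

end
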